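(* For every capacity $c\in\mathbb{N}\cup\{\infty\}$, the competitive ratio of the algorithm SmarterStart (with the best choice of its parameter) is $\rho^*\approx 2.6662$; that is, the minimum over $\Theta>1$ of the competitive ratio of $\mathrm{SmarterStart}_\Theta$ equals $\rho^*$, where $\rho^*:=\frac{3\Theta^{*2}+3}{2\Theta^*+1}$ and $\Theta^*\approx 1.7125$ is the largest solution of $\frac{3\Theta^2+3}{2\Theta+1}=\frac{2\Theta^2-\Theta+1}{\Theta^2-1}$.
   Context: Open, non-preemptive online Dial-a-Ride on the line with capacity $c\in\mathbb{N}\cup\{\infty\}$: an instance is a finite sequence $\sigma$ of requests $\sigma_i=(a_i,b_i;r_i)$ with $a_i,b_i\in\mathbb{R}$, $r_i\ge 0$. Request $\sigma_i$ is revealed at time $r_i$; it must be picked up at $a_i$ at some time $\ge r_i$ and transported to $b_i$. A single server starts at the origin at time $0$, moves along the real line with speed at most $1$, and carries at most $c$ requests simultaneously; loading and unloading take no time; a loaded request may only be unloaded at its destination; the server need not return to the origin. The objective is the completion time, i.e. the time at which all requests have been served. $\mathrm{Opt}(\sigma)$ is the minimum completion time of an offline solution knowing $\sigma$ in advance (but respecting release times). The competitive ratio of an online algorithm $\mathrm{Alg}$ is the infimum of all $\alpha$ with $\mathrm{Alg}(\sigma)\le\alpha\,\mathrm{Opt}(\sigma)$ for all $\sigma$, where $\mathrm{Alg}(\sigma)$ is its completion time. Notation: for $R\subseteq\sigma$, $L(t,p,R)$ is the smallest duration (completion time minus $t$) of a schedule that starts at position $p$ at time $t$ and serves all requests in $R$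 respecting release times. $\sigma_{\le t}$ is the set of all requests released until time $t$ (served or not); $R_t$ is the set of requests released until time $t$ but not yet served by the algorithm. Algorithm $\mathrm{SmarterStart}_\Theta$ (parameter $\Theta>1$): set $p_1=0$. For $j=1,2,\dots$: wait at $p_j$ as long as the current time $t$ satisfies $t<L(t,0,\sigma_{\le t})/(\Theta-1)$ (and as long as $R_t=\emptyset$); then set $t_j:=t$, let $S_j$ be an optimal offline schedule serving $R_t$ starting from $p_j$, execute $S_j$ (ignoring requests arriving meanwhile), and let $p_{j+1}$ be the position reached at its end. *)

theory Defs
  imports "HOL-Analysis.Analysis"
begin

section \<open>Requests and schedules\<close>

datatype request = Request (pickup: real) (destination: real) (release: real)

definition dar_instance :: "request list \<Rightarrow> bool" where
  "dar_instance \<sigma> \<longleftrightarrow> (\<forall>q\<in>set \<sigma>. 0 \<le> release q)"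

text \<open>
  Requests are referred to by their index in the sequence \<open>\<sigma>\<close>, so equal requests may occur
  repeatedly; a subset of \<open>\<sigma>\<close> is a set of indices below \<open>length \<sigma>\<close>.
\<close>

datatype action = Load nat | Unload nat

fun action_pos :: "request list \<Rightarrow> action \<Rightarrow> real" where
  "action_pos \<sigma> (Load i) = pickup (\<sigma> ! i)"
| "action_pos \<sigma> (Unload i) = destination (\<sigma> ! i)"

definition on_board :: "action list \<Rightarrow> nat set" where
  "on_board as = {i. Load i \<in> set as \<and> Unload i \<notin> set as}"

text \<open>
  A schedule consists of the trajectory \<open>x\<close> of the server and the chronological list \<open>es\<close> of
  time-stamped actions. The list order also orders actions taking place at the same time, so that
  a server that is full may unload a request and load another one at the same time and place,
  while the capacity bound is respected after every single action.
\<close>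

definition feasible_schedule ::
  "enat \<Rightarrow> request list \<Rightarrow> real \<Rightarrow> real \<Rightarrow> nat set \<Rightarrow> (real \<Rightarrow> real) \<Rightarrow> (real \<times> action) list \<Rightarrow> bool"
where
  "feasible_schedule c \<sigma> t p R x es \<longleftrightarrow>
     x t = p \<and> 1-lipschitz_on {t..} x \<and>
     sorted (map fst es) \<and>
     distinct (map snd es) \<and> set (map snd es) = Load ` R \<union> Unload ` R \<and>
     (\<forall>(s, e)\<in>set es. t \<le> s \<and> x s = action_pos \<sigma> e) \<and>
     (\<forall>s i. (s, Load i) \<in> set es \<longrightarrow> release (\<sigma> ! i) \<le> s) \<and>
     (\<forall>k<length es. \<forall>i. snd (es ! k) = Unload i \<longrightarrow> Load i \<in> set (map snd (take k es))) \<and>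
     (\<forall>k\<le>length es. enat (card (on_board (map snd (take k es)))) \<le> c)"

text \<open>The completion time of a schedule started at time \<open>t\<close>.\<close>

definition finish_time :: "real \<Rightarrow> (real \<times> action) list \<Rightarrow> real" where
  "finish_time t es = (if es = [] then t else fst (last es))"

text \<open>
  The smallest duration \<open>L(t, p, R)\<close>. For \<open>c \<ge> 1\<close> the infimum is over a nonempty set of nonnegative
  numbers, and it is attained: there are finitely many orders of the actions, and for each of them
  performing every action as early as possible is best.
\<close>

definition min_duration :: "enat \<Rightarrow> request list \<Rightarrow> real \<Rightarrow> real \<Rightarrow> nat set \<Rightarrow> real" where
  "min_duration c \<sigma> t p R =
     Inf {finish_time t es - t | x es. feasible_schedule c \<sigma> t p R x es}"

definition optimal_schedule ::
  "enat \<Rightarrow> request list \<Rightarrow> real \<Rightarrow> real \<Rightarrow> nat set \<Rightarrow> (real \<Rightarrow> real) \<Rightarrow> (real \<times> action) list \<Rightarrow> bool"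
where
  "optimal_schedule c \<sigma> t p R x es \<longleftrightarrow>
     feasible_schedule c \<sigma> t p R x es \<and> finish_time t es - t = min_duration c \<sigma> t p R"

definition Opt :: "enat \<Rightarrow> request list \<Rightarrow> real" where
  "Opt c \<sigma> = min_duration c \<sigma> 0 0 {..<length \<sigma>}"

section \<open>The algorithm SmarterStart\<close>

definition released :: "request list \<Rightarrow> real \<Rightarrow> nat set" where
  "released \<sigma> t = {i. i < length \<sigma> \<and> release (\<sigma> ! i) \<le> t}"

text \<open>
  \<open>D\<close> is the set of requests served so far, so that \<open>released \<sigma> t - D\<close> is \<open>R\<^sub>t\<close>.
\<close>

definition may_start :: "enat \<Rightarrow> real \<Rightarrow> request list \<Rightarrow> nat set \<Rightarrow> real \<Rightarrow> bool" where
  "may_start c \<Theta> \<sigma> D t \<longleftrightarrow>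
     released \<sigma> t - D \<noteq> {} \<and> \<not> t < min_duration c \<sigma> t 0 (released \<sigma> t) / (\<Theta> - 1)"

text \<open>
  \<open>smarterstart_state c \<Theta> \<sigma> T p D\<close>: in some execution on \<open>\<sigma>\<close>, the server is at position \<open>p\<close> at time
  \<open>T\<close>, has served exactly the requests in \<open>D\<close>, and either \<open>T = 0\<close> or it has just completed one of
  the schedules \<open>S\<^sub>j\<close>. This is a relation because \<open>S\<^sub>j\<close> may be any of the optimal schedules.
\<close>

inductive smarterstart_state ::
  "enat \<Rightarrow> real \<Rightarrow> request list \<Rightarrow> real \<Rightarrow> real \<Rightarrow> nat set \<Rightarrow> bool"
  for c :: enat and \<Theta> :: real and \<sigma> :: "request list"
where
  init: "smarterstart_state c \<Theta> \<sigma> 0 0 {}"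
| step: "smarterstart_state c \<Theta> \<sigma> T p D \<Longrightarrow>
    T \<le> t \<Longrightarrow> may_start c \<Theta> \<sigma> D t \<Longrightarrow> (\<And>s. T \<le> s \<Longrightarrow> s < t \<Longrightarrow> \<not> may_start c \<Theta> \<sigma> D s) \<Longrightarrow>
    optimal_schedule c \<sigma> t p (released \<sigma> t - D) x es \<Longrightarrow>
    smarterstart_state c \<Theta> \<sigma> (finish_time t es) (x (finish_time t es)) (D \<union> (released \<sigma> t - D))"

definition smarterstart_completion :: "enat \<Rightarrow> real \<Rightarrow> request list \<Rightarrow> real \<Rightarrow> bool" where
  "smarterstart_completion c \<Theta> \<sigma> C \<longleftrightarrow> (\<exists>p. smarterstart_state c \<Theta> \<sigma> C p {..<length \<sigma>})"

text \<open>
  An algorithm is represented by its completion times. It implements SmarterStart if these arise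
  from executions of SmarterStart, with ties between optimal schedules broken in any way.
\<close>

definition implements_smarterstart :: "enat \<Rightarrow> real \<Rightarrow> (request list \<Rightarrow> real) \<Rightarrow> bool" where
  "implements_smarterstart c \<Theta> Alg \<longleftrightarrow>
     (\<forall>\<sigma>. dar_instance \<sigma> \<longrightarrow> smarterstart_completion c \<Theta> \<sigma> (Alg \<sigma>))"

section \<open>Competitive ratio and constants\<close>

text \<open>Extended reals, so that an algorithm that is not competitive has ratio \<open>\<infinity>\<close>.\<close>

definition competitive_ratio :: "enat \<Rightarrow> (request list \<Rightarrow> real) \<Rightarrow> ereal" where
  "competitive_ratio c Alg =
     Inf {ereal \<alpha> | \<alpha>. \<forall>\<sigma>. dar_instance \<sigma> \<longrightarrow> Alg \<sigma> \<le> \<alpha> * Opt c \<sigma>}"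

text \<open>The side conditions exclude the poles, where division in HOL yields \<open>0\<close>.\<close>

definition Theta_star :: real where
  "Theta_star = (GREATEST \<Theta>. 2 * \<Theta> + 1 \<noteq> 0 \<and> \<Theta>\<^sup>2 - 1 \<noteq> 0 \<and>
     (3 * \<Theta>\<^sup>2 + 3) / (2 * \<Theta> + 1) = (2 * \<Theta>\<^sup>2 - \<Theta> + 1) / (\<Theta>\<^sup>2 - 1))"

definition rho_star :: real where
  "rho_star = (3 * Theta_star\<^sup>2 + 3) / (2 * Theta_star + 1)"

end

(*
  Upper bound. Compare with an offline solution completing at time z. If SmarterStart waited before
  its last schedule, the starting time is at most z / (Theta - 1), and the requests of the last
  schedule cannot be picked up offline before the preceding starting time, which bounds the way back
  from the current position. If it did not wait, the last two schedules are both compared with the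
  offline solution, following it from its first pickup among the last requests and up to its last
  delivery among the last but one requests. The two cases give the two sides of the equation for
  Theta*, the first one decreasing and the second one increasing in Theta.

  Lower bound. Each side is attained up to epsilon by an instance starting with a request at 1, for
  which the server leaves the origin at time s = 1 / (Theta - 1). Just after s a request at -s appears
  that the offline server reaches in time: either a ride from -s to 1, which ends the instance, or a
  stop at -s together with one at s + 2, so far out that the server visits -s last; once this second
  schedule is started, a request on the far right follows. For Theta > 2 the stop at s + 2 is
  replaced by a ride from 0 to s, and the last request is at 1.
*)
theory Submission
  imports Defs
begin

section \<open>Schedules\<close>

lemma feasibleD:
  assumes "feasible_schedule c \<sigma> t p R x es"
  shows feasible_start: "x t = p"
    and feasible_lipschitz: "t \<le> v \<Longrightarrow> t \<le> w \<Longrightarrow> \<bar>x v - x w\<bar> \<le> \<bar>v - w\<bar>"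
    and feasible_sorted: "sorted (map fst es)"
    and feasible_distinct: "distinct (map snd es)"
    and feasible_actions: "snd ` set es = Load ` R \<union> Unload ` R"
    and feasible_time: "(v, e) \<in> set es \<Longrightarrow> t \<le> v"
    and feasible_pos: "(v, e) \<in> set es \<Longrightarrow> x v = action_pos \<sigma> e"
    and feasible_release: "(v, Load i) \<in> set es \<Longrightarrow> release (\<sigma> ! i) \<le> v"
    and feasible_order: "k < length es \<Longrightarrow> snd (es ! k) = Unload i \<Longrightarrow>
      Load i \<in> set (map snd (take k es))"
    and feasible_capacity: "k \<le> length es \<Longrightarrow> enat (card (on_board (map snd (take k es)))) \<le> c"
proof -
  have "dist (x v) (x w) \<le> 1 * dist v w" if "t \<le> v" "t \<le> w"
    using assms that unfolding feasible_schedule_def by (intro lipschitz_onD[of 1 "{t..}"]) auto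
  then show "t \<le> v \<Longrightarrow> t \<le> w \<Longrightarrow> \<bar>x v - x w\<bar> \<le> \<bar>v - w\<bar>" by (simp add: dist_real_def)
qed (use assms in \<open>auto simp: feasible_schedule_def\<close>)

lemma feasibleI:
  assumes "x t = p" "\<And>v w. t \<le> v \<Longrightarrow> v \<le> w \<Longrightarrow> \<bar>x v - x w\<bar> \<le> w - v"
    "sorted (map fst es)" "distinct (map snd es)" "snd ` set es = Load ` R \<union> Unload ` R"
    "\<And>v e. (v, e) \<in> set es \<Longrightarrow> t \<le> v" "\<And>v e. (v, e) \<in> set es \<Longrightarrow> x v = action_pos \<sigma> e"
    "\<And>v i. (v, Load i) \<in> set es \<Longrightarrow> release (\<sigma> ! i) \<le> v"
    "\<And>k i. k < length es \<Longrightarrow> snd (es ! k) = Unload i \<Longrightarrow> Load i \<in> set (map snd (take k es))"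
    "\<And>k. k \<le> length es \<Longrightarrow> enat (card (on_board (map snd (take k es)))) \<le> c"
  shows "feasible_schedule c \<sigma> t p R x es"
proof -
  have "1-lipschitz_on {t..} x"
  proof (rule lipschitz_onI)
    fix v w assume "v \<in> {t..}" "w \<in> {t..}"
    then show "dist (x v) (x w) \<le> 1 * dist v w"
      using assms(2)[of v w] assms(2)[of w v] by (cases "v \<le> w") (auto simp: dist_real_def abs_minus_commute)
  qed simp
  then show ?thesis using assms unfolding feasible_schedule_def by auto
qed

lemma feasible_le_finish:
  assumes "feasible_schedule c \<sigma> t p R x es" "(v, e) \<in> set es"
  shows "v \<le> finish_time t es"
proof -
  obtain k where k: "k < length es" "es ! k = (v, e)" using assms(2) by (auto simp: in_set_conv_nth)
  then have "map fst es ! k \<le> map fst es ! (length es - 1)"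
    using feasible_sorted[OF assms(1)] by (intro sorted_nth_mono) auto
  then have "v \<le> fst (es ! (length es - 1))" using k by (subst (asm) (1 2) nth_map) auto
  then show ?thesis using k by (auto simp: finish_time_def last_conv_nth)
qed

lemma feasible_start_le_finish:
  assumes "feasible_schedule c \<sigma> t p R x es"
  shows "t \<le> finish_time t es"
  using feasible_time[OF assms, of "fst (last es)" "snd (last es)"] by (auto simp: finish_time_def)

lemma feasible_visit:
  assumes "feasible_schedule c \<sigma> t p R x es" "i \<in> R"
  obtains v w where "(v, Load i) \<in> set es" "(w, Unload i) \<in> set es" "t \<le> v" "v \<le> w"
    "w \<le> finish_time t es" "x v = pickup (\<sigma> ! i)" "x w = destination (\<sigma> ! i)" "release (\<sigma> ! i) \<le> v"
proof -
  have "Unload i \<in> snd ` set es" using feasible_actions[OF assms(1)] assms(2) by auto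
  then obtain w where w: "(w, Unload i) \<in> set es" by auto
  then obtain k where k: "k < length es" "es ! k = (w, Unload i)" by (auto simp: in_set_conv_nth)
  have "Load i \<in> set (map snd (take k es))" using feasible_order[OF assms(1) k(1)] k(2) by simp
  then obtain j where j: "j < k" "snd (es ! j) = Load i"
    using k(1) by (force simp: in_set_conv_nth)
  define v where "v = fst (es ! j)"
  have ej: "es ! j = (v, Load i)" using j by (simp add: v_def prod_eq_iff)
  have v: "(v, Load i) \<in> set es" using ej j k(1) by (metis nth_mem order.strict_trans)
  have "map fst es ! j \<le> map fst es ! k"
    using feasible_sorted[OF assms(1)] j k by (intro sorted_nth_mono) auto
  then have "v \<le> w" using j k ej by simp
  then show thesis
    using that[OF v w] feasible_time[OF assms(1) v] feasible_le_finish[OF assms(1) w]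
      feasible_pos[OF assms(1) v] feasible_pos[OF assms(1) w] feasible_release[OF assms(1) v] by simp
qed

lemma feasible_trip:
  assumes "feasible_schedule c \<sigma> t p R x es" "i \<in> R"
  shows "\<exists>v w. t \<le> v \<and> v \<le> w \<and> w \<le> finish_time t es \<and> x v = pickup (\<sigma> ! i) \<and>
    x w = destination (\<sigma> ! i)"
  using feasible_visit[OF assms] by metis

lemma feasible_action_unique:
  assumes "feasible_schedule c \<sigma> t p R x es" "(v, e) \<in> set es" "(w, e) \<in> set es"
  shows "v = w"
proof -
  have "inj_on snd (set es)" using feasible_distinct[OF assms(1)] by (simp add: distinct_map)
  from inj_onD[OF this _ assms(2,3)] show ?thesis by simp
qed

text \<open>A load cannot come last: its unload has to be preceded by a load of the same request,
  and no action occurs twice.\<close>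

lemma feasible_last:
  assumes "feasible_schedule c \<sigma> t p R x es" "R \<noteq> {}"
  obtains i where "i \<in> R" "(finish_time t es, Unload i) \<in> set es"
    "x (finish_time t es) = destination (\<sigma> ! i)"
proof -
  have ne: "es \<noteq> []" using feasible_actions[OF assms(1)] assms(2) by auto
  then have l: "last es = (finish_time t es, snd (last es))" by (simp add: finish_time_def prod_eq_iff)
  have m: "(finish_time t es, snd (last es)) \<in> set es" using l ne by (metis last_in_set)
  have d: "distinct (map snd es)" by (rule feasible_distinct[OF assms(1)])
  have "\<exists>i\<in>R. snd (last es) = Unload i"
  proof (rule ccontr)
    assume "\<not> ?thesis"
    moreover have "snd (last es) \<in> Load ` R \<union> Unload ` R"
      using feasible_actions[OF assms(1)] ne by (metis image_eqI last_in_set)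
    ultimately obtain i where i: "i \<in> R" "snd (last es) = Load i" by auto
    have "Unload i \<in> snd ` set es" using feasible_actions[OF assms(1)] i by auto
    then obtain k where k: "k < length es" "snd (es ! k) = Unload i" by (auto simp: in_set_conv_nth)
    have "Load i \<in> set (map snd (take k es))" by (rule feasible_order[OF assms(1) k])
    then obtain j where j: "j < k" "snd (es ! j) = Load i"
      using k(1) by (force simp: in_set_conv_nth)
    have "map snd es ! j = map snd es ! (length es - 1)"
      using j k(1) i ne by (simp add: last_conv_nth)
    then have "j = length es - 1" using d j k(1) ne by (subst (asm) nth_eq_iff_index_eq) auto
    then show False using j k by simp
  qed
  then obtain i where "i \<in> R" "snd (last es) = Unload i" by blast
  then show thesis using that[of i] m feasible_pos[OF assms(1) m] by simp
qed

lemma min_duration_le: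
  assumes "feasible_schedule c \<sigma> t p R x es"
  shows "min_duration c \<sigma> t p R \<le> finish_time t es - t"
  unfolding min_duration_def
proof (rule cInf_lower)
  show "bdd_below {finish_time t es - t | x es. feasible_schedule c \<sigma> t p R x es}"
    by (rule bdd_belowI[of _ 0]) (auto dest: feasible_start_le_finish)
qed (use assms in blast)

section \<open>Trajectories pieced together from unit-speed motion to a target\<close>

definition glide :: "real \<Rightarrow> real \<Rightarrow> real \<Rightarrow> real \<Rightarrow> real" where
  "glide t p q v = p + sgn (q - p) * min (max 0 (v - t)) \<bar>q - p\<bar>"

lemma glide_start [simp]: "v \<le> t \<Longrightarrow> glide t p q v = p"
  by (simp add: glide_def)

lemma glide_end [simp]: "t + \<bar>q - p\<bar> \<le> v \<Longrightarrow> glide t p q v = q"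
  by (simp add: glide_def min_absorb2 sgn_mult_abs)

lemma glide_lipschitz: "v \<le> w \<Longrightarrow> \<bar>glide t p q v - glide t p q w\<bar> \<le> w - v"
  unfolding glide_def by (auto simp: sgn_if min_def max_def abs_if)

lemma lipschitz_join:
  fixes x y :: "real \<Rightarrow> real"
  assumes "\<And>v w. t \<le> v \<Longrightarrow> v \<le> w \<Longrightarrow> w \<le> f \<Longrightarrow> \<bar>x v - x w\<bar> \<le> w - v"
    and "\<And>v w. f \<le> v \<Longrightarrow> v \<le> w \<Longrightarrow> \<bar>y v - y w\<bar> \<le> w - v"
    and "x f = y f" "t \<le> v" "v \<le> w"
  shows "\<bar>(if v \<le> f then x v else y v) - (if w \<le> f then x w else y w)\<bar> \<le> w - v"
  using assms(1)[of v w] assms(2)[of v w] assms(1)[of v f] assms(2)[of f w] assms(3-5) by auto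

section \<open>Replaying part of a schedule at another time\<close>

fun action_request :: "action \<Rightarrow> nat" where
  "action_request (Load i) = i"
| "action_request (Unload i) = i"

text \<open>Precedence and capacity are conditions on prefixes of the action list. This lemma and
  the next carry them over to the sublist of actions on a subset of the requests.\<close>

lemma take_filter_ex: "\<exists>k'\<le>length xs. take k (filter P xs) = filter P (take k' xs)"
proof (induction xs arbitrary: k)
  case (Cons a xs)
  show ?case
  proof (cases "P a")
    case True
    show ?thesis
    proof (cases k)
      case (Suc m)
      obtain k' where "k' \<le> length xs" "take m (filter P xs) = filter P (take k' xs)"
        using Cons.IH by blast
      then show ?thesis using True Suc by (intro exI[of _ "Suc k'"]) auto
    qed (auto intro: exI[of _ 0])
  next
    case False
    obtain k' where "k' \<le> length xs" "take k (filter P xs) = filter P (take k' xs)"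
      using Cons.IH by blast
    then show ?thesis using False by (intro exI[of _ "Suc k'"]) auto
  qed
qed auto

lemma nth_filter_ex:
  "k < length (filter P xs) \<Longrightarrow>
    \<exists>k'<length xs. filter P xs ! k = xs ! k' \<and> take k (filter P xs) = filter P (take k' xs)"
proof (induction xs arbitrary: k)
  case (Cons a xs)
  show ?case
  proof (cases "P a")
    case True
    show ?thesis
    proof (cases k)
      case (Suc m)
      then obtain k' where "k' < length xs" "filter P xs ! m = xs ! k'"
        "take m (filter P xs) = filter P (take k' xs)"
        using Cons True by force
      then show ?thesis using True Suc by (intro exI[of _ "Suc k'"]) auto
    qed (use True in \<open>auto intro: exI[of _ 0]\<close>)
  next
    case False
    then obtain k' where "k' < length xs" "filter P xs ! k = xs ! k'"
        "take k (filter P xs) = filter P (take k' xs)"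
      using Cons by force
    then show ?thesis using False by (intro exI[of _ "Suc k'"]) auto
  qed
qed auto

text \<open>
  Once the requests in \<open>R\<close> are released, any part of any schedule that contains all the actions on
  \<open>R\<close> can be replayed at a later or earlier time.
\<close>

lemma min_duration_le_replay:
  assumes feas: "feasible_schedule c \<sigma> t0 p0 R0 x es" and sub: "R \<subseteq> R0"
    and rel: "\<And>i. i \<in> R \<Longrightarrow> release (\<sigma> ! i) \<le> t" and tau: "t0 \<le> \<tau>0" "\<tau>0 \<le> \<tau>1"
    and loads: "\<And>v i. (v, Load i) \<in> set es \<Longrightarrow> i \<in> R \<Longrightarrow> \<tau>0 \<le> v"
    and unloads: "\<And>v i. (v, Unload i) \<in> set es \<Longrightarrow> i \<in> R \<Longrightarrow> v \<le> \<tau>1"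
  shows "min_duration c \<sigma> t p R \<le> \<bar>p - x \<tau>0\<bar> + (\<tau>1 - \<tau>0)"
proof -
  \<comment> \<open>The server walks from \<open>p\<close> to \<open>x \<tau>0\<close>, arriving at
    time \<open>t + d\<close>, and then follows \<open>x\<close> shifted by \<open>h\<close>,
    performing only the actions on \<open>R\<close>.\<close>
  define d where "d = \<bar>p - x \<tau>0\<bar>"
  define h where "h = t + d - \<tau>0"
  define y where "y v = (if v \<le> t + d then glide t p (x \<tau>0) v else x (v - h))" for v
  define P where "P = (\<lambda>a::real \<times> action. action_request (snd a) \<in> R)"
  define fs where "fs = map (\<lambda>(v, e). (v + h, e)) (filter P es)"
  have d0: "0 \<le> d" by (simp add: d_def)
  \<comment> \<open>Loads precede unloads, so a lower bound on loads and an upper bound on unloads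
    confine every action on \<open>R\<close> to the window.\<close>
  have win: "\<tau>0 \<le> v \<and> v \<le> \<tau>1" if "(v, e) \<in> set es" "action_request e \<in> R" for v e
  proof -
    define i where "i = action_request e"
    have i: "i \<in> R" "i \<in> R0" using that sub by (auto simp: i_def)
    from feasible_visit[OF feas i(2)] obtain v' w' where
      *: "(v', Load i) \<in> set es" "(w', Unload i) \<in> set es" "v' \<le> w'" by blast
    have "e = Load i \<or> e = Unload i" unfolding i_def by (cases e) auto
    then have "v = v' \<or> v = w'" using feasible_action_unique[OF feas] * that(1) by blast
    then show ?thesis using loads[OF *(1) i(1)] unloads[OF *(2) i(1)] *(3) by auto
  qed
  have yx: "y v = x (v - h)" if "t + d \<le> v" for v
    using that by (auto simp: y_def h_def d_def)
  have mem: "(v, e) \<in> set fs \<longleftrightarrow> (v - h, e) \<in> set es \<and> action_request e \<in> R" for v e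
    by (auto simp: fs_def P_def image_iff algebra_simps intro!: bexI[of _ "(v - h, e)"])
  have snd_fs: "map snd (take k fs) = map snd (take k (filter P es))" for k
    by (simp add: fs_def take_map case_prod_beta comp_def)
  have "feasible_schedule c \<sigma> t p R y fs"
  proof (rule feasibleI)
    show "y t = p" using d0 by (simp add: y_def)
    show "\<bar>y v - y w\<bar> \<le> w - v" if "t \<le> v" "v \<le> w" for v w
      unfolding y_def
    proof (rule lipschitz_join[where t = t])
      fix v w assume "t + d \<le> v" "v \<le> w"
      then show "\<bar>x (v - h) - x (w - h)\<bar> \<le> w - v"
        using feasible_lipschitz[OF feas, of "v - h" "w - h"] tau by (simp add: h_def)
    qed (use that glide_lipschitz in \<open>auto simp: h_def d_def\<close>)
    have s: "sorted (map fst (filter P es))"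
      using feasible_sorted[OF feas] by (simp add: sorted_filter)
    have "map fst fs = map (\<lambda>v. v + h) (map fst (filter P es))"
      by (simp add: fs_def case_prod_beta)
    then show "sorted (map fst fs)"
      using s by (simp add: sorted_iff_nth_mono)
    have "map snd fs = map snd (filter P es)" by (simp add: fs_def case_prod_beta)
    then show "distinct (map snd fs)"
      using feasible_distinct[OF feas] by (simp add: distinct_map_filter)
    have "snd ` set fs = {e \<in> snd ` set es. action_request e \<in> R}"
      by (force simp: fs_def P_def)
    then show "snd ` set fs = Load ` R \<union> Unload ` R"
      using feasible_actions[OF feas] sub by auto
    show "t \<le> v" if "(v, e) \<in> set fs" for v e
      using win[of "v - h" e] that d0 by (auto simp: mem h_def)
    show "y v = action_pos \<sigma> e" if "(v, e) \<in> set fs" for v e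
      using win[of "v - h" e] that feasible_pos[OF feas, of "v - h" e] yx[of v] by (auto simp: mem h_def)
    show "release (\<sigma> ! i) \<le> v" if "(v, Load i) \<in> set fs" for v i
      using win[of "v - h" "Load i"] that d0 rel[of i] by (auto simp: mem h_def)
    show "Load i \<in> set (map snd (take k fs))"
      if k: "k < length fs" and u: "snd (fs ! k) = Unload i" for k i
    proof -
      have k': "k < length (filter P es)" using k by (simp add: fs_def)
      obtain k' where kk: "k' < length es" "filter P es ! k = es ! k'"
        "take k (filter P es) = filter P (take k' es)" using nth_filter_ex[OF k'] by blast
      have u': "snd (es ! k') = Unload i" using u k' kk by (simp add: fs_def case_prod_beta)
      have "P (es ! k')" using k' kk(2) by (metis nth_mem mem_Collect_eq set_filter)
      then have "i \<in> R" using u' by (simp add: P_def)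
      moreover have "Load i \<in> set (map snd (take k' es))" by (rule feasible_order[OF feas kk(1) u'])
      ultimately show ?thesis unfolding snd_fs kk(3) by (force simp: P_def)
    qed
    show "enat (card (on_board (map snd (take k fs)))) \<le> c" for k
    proof -
      obtain k' where kk: "k' \<le> length es" "take k (filter P es) = filter P (take k' es)"
        using take_filter_ex by blast
      \<comment> \<open>Leaving requests out can only shrink the set on board.\<close>
      have "on_board (map snd (take k fs)) \<subseteq> on_board (map snd (take k' es))"
        unfolding snd_fs kk(2) on_board_def by (force simp: P_def)
      moreover have "finite (on_board (map snd (take k' es)))"
      proof (rule finite_subset)
        show "on_board (map snd (take k' es)) \<subseteq> action_request ` set (map snd (take k' es))"
          by (force simp: on_board_def)
      qed simp
      ultimately have "card (on_board (map snd (take k fs))) \<le> card (on_board (map snd (take k' es)))"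
        by (rule card_mono[rotated])
      then show ?thesis using feasible_capacity[OF feas kk(1)] by (meson enat_ord_simps(1) order_trans)
    qed
  qed
  from min_duration_le[OF this]
  have "min_duration c \<sigma> t p R \<le> finish_time t fs - t" .
  also have "\<dots> \<le> d + (\<tau>1 - \<tau>0)"
  proof (cases "fs = []")
    case True then show ?thesis using d0 tau by (simp add: finish_time_def)
  next
    case False
    then have "last fs \<in> set fs" by simp
    then have "(fst (last fs), snd (last fs)) \<in> set fs" by simp
    then have "fst (last fs) - h \<le> \<tau>1" using win mem by blast
    then show ?thesis using False by (simp add: finish_time_def h_def)
  qed
  finally show ?thesis by (simp add: d_def)
qed

text \<open>Replays the schedule from its first pickup among \<open>R\<close> onwards. The request
  \<open>i\<close> picked up there ties \<open>\<tau>\<close> to a release time.\<close>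

lemma feasible_first_load:
  assumes feas: "feasible_schedule c \<sigma> t0 p0 R0 x es" and "R \<subseteq> R0" "finite R" "R \<noteq> {}"
    and rel: "\<And>i. i \<in> R \<Longrightarrow> release (\<sigma> ! i) \<le> t"
  obtains i \<tau> where "i \<in> R" "release (\<sigma> ! i) \<le> \<tau>" "t0 \<le> \<tau>" "\<tau> \<le> finish_time t0 es"
    "min_duration c \<sigma> t p R \<le> \<bar>p - x \<tau>\<bar> + (finish_time t0 es - \<tau>)"
proof -
  have "\<exists>v. (v, Load i) \<in> set es" if "i \<in> R" for i
    using feasible_visit[OF feas] that assms(2) by blast
  then obtain l where l: "(l i, Load i) \<in> set es" if "i \<in> R" for i by metis
  define i where "i = arg_min_on l R"
  have i: "i \<in> R" "\<And>j. j \<in> R \<Longrightarrow> l i \<le> l j"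
    using arg_min_if_finite[OF assms(3,4), of l] by (auto simp: i_def not_less[symmetric])
  have "l i \<le> v" if "(v, Load j) \<in> set es" "j \<in> R" for v j
    using feasible_action_unique[OF feas that(1) l[OF that(2)]] i(2)[OF that(2)] by simp
  then have "min_duration c \<sigma> t p R \<le> \<bar>p - x (l i)\<bar> + (finish_time t0 es - l i)"
    using feasible_time[OF feas l[OF i(1)]] feasible_le_finish[OF feas] l[OF i(1)]
    by (intro min_duration_le_replay[OF feas assms(2) rel]) auto
  then show thesis
    using that[OF i(1) feasible_release[OF feas l[OF i(1)]]] feasible_time[OF feas l[OF i(1)]]
      feasible_le_finish[OF feas l[OF i(1)]] by simp
qed

text \<open>The counterpart: the schedule is replayed from its start up to its last delivery among
  \<open>R\<close>.\<close>

lemma feasible_last_unload: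
  assumes feas: "feasible_schedule c \<sigma> t0 p0 R0 x es" and "R \<subseteq> R0" "finite R" "R \<noteq> {}"
    and rel: "\<And>i. i \<in> R \<Longrightarrow> release (\<sigma> ! i) \<le> t"
  obtains i \<tau> where "i \<in> R" "t0 \<le> \<tau>" "\<tau> \<le> finish_time t0 es" "x \<tau> = destination (\<sigma> ! i)"
    "min_duration c \<sigma> t p R \<le> \<bar>p - p0\<bar> + (\<tau> - t0)"
proof -
  have "\<exists>v. (v, Unload i) \<in> set es" if "i \<in> R" for i
    using feasible_visit[OF feas] that assms(2) by blast
  then obtain l where l: "(l i, Unload i) \<in> set es" if "i \<in> R" for i by metis
  define i where "i = arg_min_on (\<lambda>j. - l j) R"
  have i: "i \<in> R" "\<And>j. j \<in> R \<Longrightarrow> l j \<le> l i"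
    using arg_min_if_finite[OF assms(3,4), of "\<lambda>j. - l j"] by (auto simp: i_def not_less[symmetric])
  have "v \<le> l i" if "(v, Unload j) \<in> set es" "j \<in> R" for v j
    using feasible_action_unique[OF feas that(1) l[OF that(2)]] i(2)[OF that(2)] by simp
  then have "min_duration c \<sigma> t p R \<le> \<bar>p - x t0\<bar> + (l i - t0)"
    using feasible_time[OF feas] l[OF i(1)]
    by (intro min_duration_le_replay[OF feas assms(2) rel]) auto
  then show thesis
    using that[OF i(1) feasible_time[OF feas l[OF i(1)]] feasible_le_finish[OF feas l[OF i(1)]]]
      feasible_pos[OF feas l[OF i(1)]] feasible_start[OF feas] by simp
qed

section \<open>Building schedules request by request\<close>

text \<open>Recording the end position allows a schedule to be extended; completion by
  \<open>f\<close> instead of at \<open>f\<close> leaves room for waiting.\<close>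

definition reachable ::
  "enat \<Rightarrow> request list \<Rightarrow> real \<Rightarrow> real \<Rightarrow> nat set \<Rightarrow> real \<Rightarrow> real \<Rightarrow> bool"
where
  "reachable c \<sigma> t p R f q \<longleftrightarrow> t \<le> f \<and>
     (\<exists>x es. feasible_schedule c \<sigma> t p R x es \<and> finish_time t es \<le> f \<and> x f = q)"

lemma reachable_start: "reachable c \<sigma> t p {} t p"
proof -
  have "feasible_schedule c \<sigma> t p {} (\<lambda>_. p) []"
    by (rule feasibleI) (auto simp: on_board_def zero_enat_def[symmetric])
  then show ?thesis unfolding reachable_def finish_time_def by force
qed

text \<open>The server walks to the pickup, waits there until \<open>g\<close> and rides to the
  destination. All earlier requests have been delivered, so it carries a single request and any
  \<open>c \<ge> 1\<close> suffices.\<close>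

lemma reachable_serve:
  assumes "reachable c \<sigma> t p R f q" "1 \<le> c" "i \<notin> R" "release (\<sigma> ! i) \<le> g"
    and g: "f + \<bar>pickup (\<sigma> ! i) - q\<bar> \<le> g"
    and h: "g + \<bar>destination (\<sigma> ! i) - pickup (\<sigma> ! i)\<bar> \<le> h" "b = destination (\<sigma> ! i)"
  shows "reachable c \<sigma> t p (insert i R) h b"
proof -
  from assms(1) obtain x es where feas: "feasible_schedule c \<sigma> t p R x es"
    and fin: "finish_time t es \<le> f" "x f = q" "t \<le> f" unfolding reachable_def by blast
  define a where "a = pickup (\<sigma> ! i)"
  define h' where "h' = g + \<bar>b - a\<bar>"
  define z where "z v = (if v \<le> g then glide f q a v else glide g a b v)" for v
  define y where "y v = (if v \<le> f then x v else z v)" for v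
  define fs where "fs = es @ [(g, Load i), (h', Unload i)]"
  have fg: "f + \<bar>a - q\<bar> \<le> g" "f \<le> g" "g \<le> h'" "h' \<le> h"
    using g h by (auto simp: a_def h'_def)
  have ne: "Load i \<notin> snd ` set es" "Unload i \<notin> snd ` set es"
    using feasible_actions[OF feas] assms(3) by auto
  have pos: "y v = x v" if "v \<le> f" for v using that by (simp add: y_def)
  have yg: "y g = a" using fg fin by (cases "g = f") (auto simp: y_def z_def)
  \<comment> \<open>If \<open>h' \<le> f\<close>, the whole trip has length zero, and
    \<open>q\<close>, the pickup and \<open>b\<close> coincide.\<close>
  have yh: "y v = b" if "h' \<le> v" for v
  proof (cases "v \<le> f")
    case True
    then have "v = f" "a = q" "b = a" using fg that by (auto simp: h'_def)
    then show ?thesis using fin by (simp add: y_def)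
  qed (use fg that in \<open>auto simp: y_def z_def h'_def\<close>)
  have le: "v \<le> f" if "(v, e) \<in> set es" for v e
    using feasible_le_finish[OF feas that] fin by simp
  have ob: "on_board (map snd es) = {}"
    using feasible_actions[OF feas] unfolding on_board_def by auto
  have "feasible_schedule c \<sigma> t p (insert i R) y fs"
  proof (rule feasibleI)
    show "y t = p" using fin feasible_start[OF feas] by (simp add: y_def)
    show "\<bar>y v - y w\<bar> \<le> w - v" if vw: "t \<le> v" "v \<le> w" for v w
      unfolding y_def
    proof (rule lipschitz_join[where t = t])
      show "\<bar>z v - z w\<bar> \<le> w - v" if "f \<le> v" "v \<le> w" for v w
        unfolding z_def
        by (rule lipschitz_join[where t = f]) (use that fg glide_lipschitz in auto)
      show "\<bar>x v - x w\<bar> \<le> w - v" if "t \<le> v" "v \<le> w" "w \<le> f" for v w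
        using feasible_lipschitz[OF feas, of v w] that by simp
      show "x f = z f" using fin fg by (simp add: z_def)
    qed (use vw in auto)
    show "sorted (map fst fs)"
      using feasible_sorted[OF feas] le fg by (fastforce simp: fs_def sorted_append)
    show "distinct (map snd fs)"
      using feasible_distinct[OF feas] ne by (auto simp: fs_def)
    show "snd ` set fs = Load ` insert i R \<union> Unload ` insert i R"
      using feasible_actions[OF feas] by (auto simp: fs_def)
    show "t \<le> v" if "(v, e) \<in> set fs" for v e
      using that feasible_time[OF feas, of v e] fin fg by (auto simp: fs_def)
    show "y v = action_pos \<sigma> e" if "(v, e) \<in> set fs" for v e
      using that feasible_pos[OF feas, of v e] pos le yg yh[of h'] h(2) by (auto simp: fs_def a_def)
    show "release (\<sigma> ! j) \<le> v" if "(v, Load j) \<in> set fs" for v j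
      using that feasible_release[OF feas, of v j] assms(4) by (auto simp: fs_def)
    show "Load j \<in> set (map snd (take k fs))" if "k < length fs" "snd (fs ! k) = Unload j" for k j
    proof -
      consider "k < length es" | "k = length es" | "k = Suc (length es)"
        using \<open>k < length fs\<close> by (fastforce simp: fs_def)
      then show ?thesis
        using that feasible_order[OF feas, of k j] by cases (auto simp: fs_def nth_append)
    qed
    show "enat (card (on_board (map snd (take k fs)))) \<le> c" if kle: "k \<le> length fs" for k
    proof -
      consider "k \<le> length es" | "k = Suc (length es)" | "k = Suc (Suc (length es))"
        using kle by (fastforce simp: fs_def)
      then show ?thesis
      proof cases
        case 1 then show ?thesis using feasible_capacity[OF feas] by (simp add: fs_def)
      next
        case 2
        have "on_board (map snd (take k fs)) \<subseteq> {i}"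
          using ob 2 by (auto simp: fs_def on_board_def)
        then have "card (on_board (map snd (take k fs))) \<le> 1"
          by (metis card.empty card_insert_if card_mono empty_iff finite.intros One_nat_def)
        then have "enat (card (on_board (map snd (take k fs)))) \<le> 1"
          by (metis enat_ord_simps(1) one_enat_def)
        then show ?thesis using assms(2) by order
      next
        case 3
        have "on_board (map snd (take k fs)) = {}"
          using ob 3 by (auto simp: fs_def on_board_def)
        then show ?thesis by (simp add: zero_enat_def[symmetric])
      qed
    qed
  qed
  moreover have "finish_time t fs \<le> h" using fg by (simp add: fs_def finish_time_def)
  moreover have "y h = b" "t \<le> h" using yh fg fin by auto
  ultimately show ?thesis unfolding reachable_def by blast
qed

lemma min_duration_le_reachable: "reachable c \<sigma> t p R f q \<Longrightarrow> min_duration c \<sigma> t p R \<le> f - t"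
  unfolding reachable_def using min_duration_le by force

text \<open>Trips one after another serve any finite set, so the infimum in
  \<open>min_duration\<close> is over a nonempty set.\<close>

lemma reachable_exists: "finite R \<Longrightarrow> 1 \<le> c \<Longrightarrow> \<exists>f q. reachable c \<sigma> t p R f q"
proof (induction R rule: finite_induct)
  case empty then show ?case using reachable_start by blast
next
  case (insert i R)
  then obtain f q where "reachable c \<sigma> t p R f q" by blast
  from reachable_serve[OF this insert.prems insert.hyps(2), where g =
      "max (release (\<sigma> ! i)) (f + \<bar>pickup (\<sigma> ! i) - q\<bar>)"]
  show ?case by fastforce
qed

section \<open>Lower bounds and a triangle inequality for the shortest duration\<close>

lemma min_duration_ge:
  assumes "finite R" "1 \<le> c"
    "\<And>x es. feasible_schedule c \<sigma> t p R x es \<Longrightarrow> b \<le> finish_time t es - t"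
  shows "b \<le> min_duration c \<sigma> t p R"
  unfolding min_duration_def
proof (rule cInf_greatest)
  show "{finish_time t es - t | x es. feasible_schedule c \<sigma> t p R x es} \<noteq> {}"
    using reachable_exists[OF assms(1,2)] unfolding reachable_def by blast
qed (use assms(3) in blast)

text \<open>Walk from \<open>p\<close> to \<open>q\<close>, then follow any schedule from
  \<open>q\<close> with the actions outside \<open>R\<close> left out.\<close>

lemma min_duration_triangle:
  assumes "finite R'" "1 \<le> c" "R \<subseteq> R'" "\<And>i. i \<in> R \<Longrightarrow> release (\<sigma> ! i) \<le> t"
  shows "min_duration c \<sigma> t p R \<le> \<bar>p - q\<bar> + min_duration c \<sigma> t q R'"
proof -
  have "min_duration c \<sigma> t p R - \<bar>p - q\<bar> \<le> min_duration c \<sigma> t q R'"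
  proof (rule min_duration_ge[OF assms(1,2)])
    fix x es assume feas: "feasible_schedule c \<sigma> t q R' x es"
    have "min_duration c \<sigma> t p R \<le> \<bar>p - x t\<bar> + (finish_time t es - t)"
      using feasible_time[OF feas] feasible_le_finish[OF feas] feasible_start_le_finish[OF feas]
      by (intro min_duration_le_replay[OF feas assms(3,4)]) auto
    then show "min_duration c \<sigma> t p R - \<bar>p - q\<bar> \<le> finish_time t es - t"
      using feasible_start[OF feas] by simp
  qed
  then show ?thesis by simp
qed

lemma destination_le_min_duration:
  assumes "finite R" "1 \<le> c" "i \<in> R"
  shows "\<bar>destination (\<sigma> ! i) - p\<bar> \<le> min_duration c \<sigma> t p R"
proof (rule min_duration_ge[OF assms(1,2)])
  fix x es assume feas: "feasible_schedule c \<sigma> t p R x es"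
  from feasible_visit[OF feas assms(3)] obtain w where
    "t \<le> w" "w \<le> finish_time t es" "x w = destination (\<sigma> ! i)" by (metis order_trans)
  then show "\<bar>destination (\<sigma> ! i) - p\<bar> \<le> finish_time t es - t"
    using feasible_lipschitz[OF feas, of w t] feasible_start[OF feas] by simp
qed

section \<open>Upper bound\<close>

text \<open>Here \<open>t\<close> and \<open>p\<close> are starting time and position of the last
  schedule and \<open>s\<close> is the preceding starting time. An offline solution completing at
  \<open>z\<close> visits \<open>p\<close> at \<open>\<tau>p\<close> and makes its first pickup
  among the last requests at time \<open>\<tau>\<close> in \<open>a\<close>. The point is to bound
  the excess \<open>\<bar>p - a\<bar> - \<tau>\<close> over \<open>t + z\<close>.\<close>

lemma waiting_bound:
  fixes \<Theta> A t p a z \<tau> \<tau>p s :: real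
  assumes "1 < \<Theta>" "A \<le> t + \<bar>p - a\<bar> + (z - \<tau>)" "t \<le> z / (\<Theta> - 1)" "\<tau> \<le> z" "\<tau>p \<le> z" "0 \<le> \<tau>p"
    and lip: "\<bar>p - a\<bar> \<le> \<bar>\<tau>p - \<tau>\<bar>" and "\<bar>a\<bar> \<le> \<tau>" "s \<le> \<tau>" "\<bar>p\<bar> \<le> (\<Theta> - 1) * s"
  shows "A \<le> (2 * \<Theta>\<^sup>2 - \<Theta> + 1) / (\<Theta>\<^sup>2 - 1) * z"
proof -
  have "\<Theta>\<^sup>2 - 1 = (\<Theta> - 1) * (\<Theta> + 1)" by (simp add: power2_eq_square algebra_simps)
  then have eq: "(2 * \<Theta>\<^sup>2 - \<Theta> + 1) / (\<Theta>\<^sup>2 - 1) = \<Theta> / (\<Theta> - 1) + (\<Theta> - 1) / (\<Theta> + 1)"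
    using assms(1) by (simp add: divide_simps power2_eq_square) (simp add: algebra_simps)
  have z0: "0 \<le> z" using assms by linarith
  have th: "\<Theta> / (\<Theta> - 1) * z = z + z / (\<Theta> - 1)" using assms(1) by (simp add: field_simps)
  have e: "\<bar>p - a\<bar> - \<tau> \<le> (\<Theta> - 1) / (\<Theta> + 1) * z"
  proof (cases "\<tau>p \<le> \<tau>")
    case True
    have "0 \<le> (\<Theta> - 1) / (\<Theta> + 1) * z" using assms(1) z0 by simp
    then show ?thesis using True lip assms(6) by linarith
  next
    \<comment> \<open>Visiting \<open>p\<close> after \<open>a\<close> gives
      \<open>\<bar>p - a\<bar> \<le> z - \<tau>\<close>; the distances of both points from the
      origin give \<open>\<bar>p - a\<bar> \<le> \<Theta> * \<tau>\<close>. Adding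
      \<open>\<Theta> - 1\<close> times the first and twice the second yields the claim.\<close>
    case False
    then have "\<tau> + \<bar>p - a\<bar> \<le> z" using lip assms(5) by linarith
    then have "(\<Theta> - 1) * (\<tau> + \<bar>p - a\<bar>) \<le> (\<Theta> - 1) * z" using assms(1) by (intro mult_left_mono) auto
    moreover have "(\<Theta> - 1) * s \<le> (\<Theta> - 1) * \<tau>" using assms(1,9) by (intro mult_left_mono) auto
    then have "\<bar>p - a\<bar> \<le> \<Theta> * \<tau>" using assms(8,10) by (simp add: algebra_simps)
    ultimately have "(\<bar>p - a\<bar> - \<tau>) * (\<Theta> + 1) \<le> (\<Theta> - 1) * z" by (simp add: algebra_simps)
    then show ?thesis using assms(1) by (simp add: field_simps)
  qed
  show ?thesis unfolding eq distrib_right th using assms(2,3) e by linarith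
qed

text \<open>
  In the next lemma \<open>t\<close> and \<open>l\<close> are starting time and duration of the last but one schedule, which
  leads from \<open>u\<close> to \<open>q\<close>, while \<open>s\<close> is the preceding starting time. An offline solution completing
  at time \<open>z\<close> is at \<open>q\<close>, \<open>w\<close>, \<open>a\<close> at the times \<open>\<tau>q\<close>, \<open>\<tau>w\<close>, \<open>\<tau>a\<close>, where \<open>w\<close> is its last destination
  among the requests of the last but one schedule and \<open>a\<close> its first pickup among those of the last
  one. Either \<open>l - \<tau>q\<close> is small, or both \<open>u\<close> and \<open>q\<close> are close to the origin; then \<open>w\<close> is far away,
  so that the detour through \<open>w\<close> makes \<open>\<bar>w - q\<bar> + \<bar>u\<bar>\<close> small.
\<close>

lemma not_waiting_bound:
  fixes \<Theta> A t l u q a w z s \<tau>q \<tau>w \<tau>a :: real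
  assumes \<Theta>: "1 < \<Theta>" "\<Theta> \<le> 2" and A: "A \<le> t + l + \<bar>q - a\<bar> + (z - \<tau>a)"
    and t: "0 \<le> t" "t \<le> \<tau>a" "\<tau>a \<le> z" and z: "\<tau>q \<le> z" "\<tau>w \<le> z"
    and qa: "\<bar>q - a\<bar> \<le> \<bar>\<tau>q - \<tau>a\<bar>" and wa: "\<bar>w - a\<bar> \<le> \<bar>\<tau>w - \<tau>a\<bar>"
    and s: "\<bar>u\<bar> \<le> (\<Theta> - 1) * s" "s \<le> t" "s \<le> \<tau>q" and q: "\<bar>q\<bar> \<le> \<tau>q"
    and l: "l \<le> \<bar>u\<bar> + (\<Theta> - 1) * t" "l \<le> \<bar>u\<bar> + \<tau>w" "\<bar>w - u\<bar> + \<bar>w - q\<bar> \<le> l"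
  shows "A \<le> (3 * \<Theta>\<^sup>2 + 3) / (2 * \<Theta> + 1) * z"
proof -
  \<comment> \<open>These units make the estimates linear: \<open>(\<Theta> - 1) * t\<close> becomes
    \<open>2 * m + k\<close>, and it suffices to stay below
    \<open>2 * z + 3 * m - k\<close>.\<close>
  define k where "k = (\<Theta> - 1) * t / (2 * \<Theta> + 1)"
  define m where "m = \<Theta> * k"
  have tz: "t \<le> z" using t by simp
  have k: "(\<Theta> - 1) * t = 2 * m + k"
  proof -
    have "(2 * \<Theta> + 1) * k = (\<Theta> - 1) * t" using \<Theta> by (simp add: k_def)
    then show ?thesis by (simp add: m_def algebra_simps)
  qed
  have k0: "0 \<le> k" using \<Theta> t by (simp add: k_def)
  have km: "k \<le> m" using \<Theta> k0 by (simp add: m_def mult_le_cancel_right1)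
  have "(3 * \<Theta>\<^sup>2 + 3) / (2 * \<Theta> + 1) * z - 2 * z = (3 * \<Theta> - 1) * ((\<Theta> - 1) * z / (2 * \<Theta> + 1))"
    using \<Theta> by (simp add: field_simps power2_eq_square)
  moreover have "(3 * \<Theta> - 1) * k \<le> (3 * \<Theta> - 1) * ((\<Theta> - 1) * z / (2 * \<Theta> + 1))"
    using \<Theta> tz by (auto simp: k_def intro!: mult_left_mono divide_right_mono)
  ultimately have goal: "2 * z + 3 * m - k \<le> (3 * \<Theta>\<^sup>2 + 3) / (2 * \<Theta> + 1) * z"
    by (simp add: m_def algebra_simps)
  have z0: "0 \<le> z" using t by simp
  have u: "\<bar>u\<bar> \<le> (\<Theta> - 1) * t"
    using s(1) mult_left_mono[OF s(2), of "\<Theta> - 1"] \<Theta> by linarith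
  show ?thesis
  proof (cases "\<tau>a < \<tau>q")
    \<comment> \<open>If \<open>q\<close> is visited after \<open>a\<close>, the way from
      \<open>q\<close> to \<open>a\<close> takes at most \<open>z - t\<close>, and the crude bound
      \<open>l \<le> 2 * (\<Theta> - 1) * t\<close> suffices.\<close>
    case True
    have "\<bar>q - a\<bar> \<le> z - t" using qa True t z by linarith
    then have "A \<le> t + l + 2 * (z - t)" using A t by (simp add: algebra_simps)
    then have A': "A \<le> 2 * z + (2 * \<Theta> - 3) * t" using l(1) u by (simp add: algebra_simps)
    show ?thesis
    proof (cases "2 * \<Theta> \<le> 3")
      case True
      then have "(2 * \<Theta> - 3) * t \<le> 0" using t by (simp add: mult_nonpos_nonneg)
      then show ?thesis using A' goal km k0 by linarith
    next
      case False
      then have "(2 * \<Theta> - 3) * t \<le> (2 * \<Theta> - 3) * z" using tz by (intro mult_left_mono) auto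
      then have "A \<le> (2 * \<Theta> - 1) * z" using A' by (simp add: algebra_simps)
      \<comment> \<open>After clearing the denominator this is
        \<open>\<Theta>\<^sup>2 \<le> 4\<close>.\<close>
      also have "\<dots> \<le> (3 * \<Theta>\<^sup>2 + 3) / (2 * \<Theta> + 1) * z"
      proof (rule mult_right_mono[OF _ z0])
        have "\<Theta> * \<Theta> \<le> 2 * 2" using \<Theta> by (intro mult_mono) auto
        then show "2 * \<Theta> - 1 \<le> (3 * \<Theta>\<^sup>2 + 3) / (2 * \<Theta> + 1)"
          using \<Theta> by (simp add: field_simps power2_eq_square)
      qed
      finally show ?thesis .
    qed
  next
    case False
    show ?thesis
    proof (cases "l - \<tau>q \<le> 3 * m - k")
      case True
      then show ?thesis using A qa False goal tz by linarith
    next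
      case large: False
      \<comment> \<open>A large \<open>l - \<tau>q\<close> bounds \<open>\<tau>q\<close> in terms of
        \<open>\<bar>u\<bar>\<close>, while \<open>s \<le> \<tau>q\<close> bounds
        \<open>\<bar>u\<bar>\<close> in terms of \<open>\<tau>q\<close>; together they bound both by
        \<open>k\<close> and \<open>m\<close>.\<close>
      have q': "\<tau>q < \<bar>u\<bar> + 2 * k - m" using large l(1) k by linarith
      have "\<bar>u\<bar> \<le> (\<Theta> - 1) * \<tau>q" using s(1) mult_left_mono[OF s(3), of "\<Theta> - 1"] \<Theta> by linarith
      also have "\<dots> < (\<Theta> - 1) * (\<bar>u\<bar> + 2 * k - m)" using q' \<Theta> by (intro mult_strict_left_mono) auto
      finally have "(2 - \<Theta>) * \<bar>u\<bar> < (2 - \<Theta>) * (m - k)"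
        by (simp add: m_def algebra_simps)
      then have u': "\<bar>u\<bar> < m - k" using \<Theta> by (simp add: mult_less_cancel_left)
      \<comment> \<open>Adds two bounds on \<open>\<bar>w - q\<bar>\<close>: a far \<open>w\<close>
        leaves little of \<open>l\<close> for the way from \<open>w\<close> to \<open>q\<close>, and
        a near one gives \<open>\<bar>w\<bar> + \<bar>q\<bar>\<close>.\<close>
      have "2 * \<bar>w - q\<bar> \<le> 2 * m + k + 2 * \<bar>u\<bar> - \<bar>w\<bar> + (\<bar>w\<bar> + \<bar>q\<bar>)"
        using l(1,3) k abs_triangle_ineq2[of w u] abs_triangle_ineq4[of w q] by linarith
      then have D: "\<bar>w - q\<bar> + \<bar>u\<bar> \<le> 3 * m - k" using q q' u' by linarith
      show ?thesis
      proof (cases "\<tau>w \<le> \<tau>a")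
        case True
        \<comment> \<open>Going from \<open>q\<close> to \<open>a\<close> through \<open>w\<close>
          lets \<open>\<tau>w\<close> cancel against
          \<open>l \<le> \<bar>u\<bar> + \<tau>w\<close>.\<close>
        have "A \<le> t + l + \<bar>w - q\<bar> + (\<tau>a - \<tau>w) + (z - \<tau>a)" using A wa True by linarith
        then show ?thesis using l(2) D goal tz by linarith
      next
        case False
        then have "\<bar>w - a\<bar> \<le> z - t" using wa t z by linarith
        then have "A \<le> t + l + \<bar>w - q\<bar> + 2 * (z - t)" using A t by (simp add: algebra_simps)
        then have "A \<le> 2 * z + (\<Theta> - 2) * t + 3 * m - k" using l(1) D by (simp add: algebra_simps)
        moreover have "(\<Theta> - 2) * t \<le> 0" using \<Theta> t by (simp add: mult_nonpos_nonneg)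
        ultimately show ?thesis using goal by linarith
      qed
    qed
  qed
qed

section \<open>Executions of SmarterStart compared with an offline schedule\<close>

lemma finite_released [simp]: "finite (released \<sigma> t)"
  by (simp add: released_def)

lemma may_startD:
  assumes "may_start c \<Theta> \<sigma> D t" "1 < \<Theta>"
  shows "released \<sigma> t - D \<noteq> {}" "min_duration c \<sigma> t 0 (released \<sigma> t) \<le> (\<Theta> - 1) * t"
  using assms by (auto simp: may_start_def field_simps not_less)

text \<open>\<open>s\<close> is the starting time of the schedule that led to \<open>p\<close>, or
  0. At that time a tour of all released requests from the origin takes at most
  \<open>(\<Theta> - 1) * s\<close>, so \<open>p\<close>, a destination among them, is no farther
  away.\<close>

lemma smarterstart_state_invariant:
  assumes "smarterstart_state c \<Theta> \<sigma> T p D" "1 \<le> c" "1 < \<Theta>" "dar_instance \<sigma>"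
  shows "D \<subseteq> {..<length \<sigma>} \<and> (\<exists>s\<ge>0. s \<le> T \<and> \<bar>p\<bar> \<le> (\<Theta> - 1) * s \<and>
    (\<forall>i<length \<sigma>. i \<notin> D \<longrightarrow> s \<le> release (\<sigma> ! i)) \<and>
    (p = 0 \<or> (\<exists>i<length \<sigma>. p = destination (\<sigma> ! i))))"
  using assms(1)
proof cases
  case init
  then show ?thesis using assms(4) by (auto simp: dar_instance_def intro!: exI[of _ 0])
next
  case (step T0 p0 D0 t x es)
  let ?R = "released \<sigma> t - D0"
  have feas: "feasible_schedule c \<sigma> t p0 ?R x es" using step by (simp add: optimal_schedule_def)
  have "D0 \<subseteq> {..<length \<sigma>} \<and> 0 \<le> T0" using step(4)
  proof (induction)
    case (step T p D t x es)
    then have "t \<le> finish_time t es" unfolding optimal_schedule_def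
      by (blast intro: feasible_start_le_finish)
    then show ?case using step by (auto simp: released_def)
  qed auto
  note D0 = this
  obtain i where i: "i \<in> ?R" "p = destination (\<sigma> ! i)"
    using feasible_last[OF feas] may_startD[OF step(6) assms(3)] step(2) by metis
  have "\<bar>p\<bar> \<le> (\<Theta> - 1) * t"
    using destination_le_min_duration[of "released \<sigma> t" c i \<sigma> 0 t] i may_startD[OF step(6) assms(3)] assms(2)
    by auto
  moreover have "t \<le> T" using feasible_start_le_finish[OF feas] step by simp
  ultimately show ?thesis
    using i D0 step(3,5) by (auto simp: released_def intro!: exI[of _ t])
qed

text \<open>Comparing with an arbitrary offline schedule avoids the question whether an optimal one
  exists.\<close>

lemma smarterstart_upper_bound:
  assumes c: "1 \<le> c" and \<Theta>: "1 < \<Theta>" "\<Theta> \<le> 2" and \<sigma>: "dar_instance \<sigma>"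
    and state: "smarterstart_state c \<Theta> \<sigma> C p' {..<length \<sigma>}"
    and feas: "feasible_schedule c \<sigma> 0 0 {..<length \<sigma>} x es"
    and \<rho>: "(2 * \<Theta>\<^sup>2 - \<Theta> + 1) / (\<Theta>\<^sup>2 - 1) \<le> \<rho>" "(3 * \<Theta>\<^sup>2 + 3) / (2 * \<Theta> + 1) \<le> \<rho>"
  shows "C \<le> \<rho> * finish_time 0 es"
proof -
  define z where "z = finish_time 0 es"
  have z0: "0 \<le> z" unfolding z_def by (rule feasible_start_le_finish[OF feas])
  have \<rho>0: "0 \<le> \<rho>" using \<rho>(2) \<Theta> by (smt (verit) divide_nonneg_pos zero_le_power2)
  have x0: "x 0 = 0" by (rule feasible_start[OF feas])
  have lip: "\<bar>x v - x w\<bar> \<le> \<bar>v - w\<bar>" if "0 \<le> v" "0 \<le> w" for v w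
    using feasible_lipschitz[OF feas] that by simp
  have x_le: "\<bar>x v\<bar> \<le> v" if "0 \<le> v" for v using lip[of v 0] x0 that by simp
  show ?thesis
    using state
  proof cases
    case init
    then show ?thesis using \<rho>0 z0 by (simp add: z_def)
  next
    case (step T p D t y fs)
    define R where "R = released \<sigma> t - D"
    have R: "finite R" "R \<noteq> {}" "R \<subseteq> {..<length \<sigma>}" "\<And>i. i \<in> R \<Longrightarrow> release (\<sigma> ! i) \<le> t"
      using may_startD[OF step(6) \<Theta>(1)] by (auto simp: R_def released_def)
    have C: "C = t + min_duration c \<sigma> t p R" using step by (simp add: R_def optimal_schedule_def)
    obtain i \<tau> where \<tau>: "i \<in> R" "release (\<sigma> ! i) \<le> \<tau>" "0 \<le> \<tau>" "\<tau> \<le> z"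
      "min_duration c \<sigma> t p R \<le> \<bar>p - x \<tau>\<bar> + (z - \<tau>)"
      using feasible_first_load[OF feas R(3,1,2,4), where p = p] unfolding z_def by blast
    have iD: "i < length \<sigma>" "i \<notin> D" using \<tau>(1) R(3) by (auto simp: R_def)
    have rel_z: "release (\<sigma> ! j) \<le> z" if "j < length \<sigma>" for j
      using feasible_visit[OF feas, of j] that unfolding z_def
      by (metis lessThan_iff order_trans)
    obtain s where s: "0 \<le> s" "s \<le> T" "\<bar>p\<bar> \<le> (\<Theta> - 1) * s"
      "\<And>j. j < length \<sigma> \<Longrightarrow> j \<notin> D \<Longrightarrow> s \<le> release (\<sigma> ! j)"
      "p = 0 \<or> (\<exists>j<length \<sigma>. p = destination (\<sigma> ! j))"
      using smarterstart_state_invariant[OF step(4) c \<Theta>(1) \<sigma>] by blast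
    have Opt_le: "min_duration c \<sigma> v 0 {..<length \<sigma>} \<le> z" if "z \<le> v" for v
    proof -
      have "min_duration c \<sigma> v 0 {..<length \<sigma>} \<le> \<bar>0 - x 0\<bar> + (z - 0)"
      proof (rule min_duration_le_replay[OF feas])
        show "\<And>j. j \<in> {..<length \<sigma>} \<Longrightarrow> release (\<sigma> ! j) \<le> v" using rel_z that by fastforce
      qed (use z0 feasible_time[OF feas] feasible_le_finish[OF feas] in \<open>auto simp: z_def\<close>)
      then show ?thesis using x0 by simp
    qed
    \<comment> \<open>From time \<open>z\<close> on all requests are known and the tour from the
      origin takes at most \<open>z\<close>. So an idle server may start at
      \<open>z / (\<Theta> - 1)\<close>, which is not before \<open>z\<close> because of
      \<open>\<Theta> \<le> 2\<close>.\<close>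
    have wait: "t \<le> z / (\<Theta> - 1) \<or> t = T"
    proof (rule ccontr)
      assume neg: "\<not> ?thesis"
      define v where "v = max T (z / (\<Theta> - 1))"
      have zv: "z \<le> z / (\<Theta> - 1)" using \<Theta> z0 mult_right_mono[OF \<Theta>(2) z0] by (simp add: field_simps)
      then have v: "T \<le> v" "v < t" "z \<le> v" "z / (\<Theta> - 1) \<le> v" using neg step(5) by (auto simp: v_def)
      have rv: "released \<sigma> v = {..<length \<sigma>}" using rel_z v(3) by (fastforce simp: released_def)
      have "v < min_duration c \<sigma> v 0 {..<length \<sigma>} / (\<Theta> - 1)"
        using step(7)[OF v(1,2)] iD rv by (auto simp: may_start_def)
      also have "\<dots> \<le> z / (\<Theta> - 1)" using Opt_le[OF v(3)] \<Theta> by (intro divide_right_mono) auto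
      finally show False using v by simp
    qed
    show ?thesis
    proof (cases "t \<le> z / (\<Theta> - 1)")
      case True
      obtain \<tau>p where \<tau>p: "0 \<le> \<tau>p" "\<tau>p \<le> z" "x \<tau>p = p"
      proof (cases "p = 0")
        case True then show ?thesis using that[of 0] x0 z0 by simp
      next
        case False
        then obtain j where j: "j \<in> {..<length \<sigma>}" "p = destination (\<sigma> ! j)" using s(5) by auto
        from feasible_visit[OF feas j(1)] show ?thesis using that j(2) unfolding z_def
          by (metis order_trans)
      qed
      have "C \<le> (2 * \<Theta>\<^sup>2 - \<Theta> + 1) / (\<Theta>\<^sup>2 - 1) * z"
        using \<tau> \<tau>p s(3,4) iD x_le[of \<tau>] lip[of \<tau>p \<tau>] C True
        by (intro waiting_bound[OF \<Theta>(1), where t = t and p = p and a = "x \<tau>" and \<tau> = \<tau> and \<tau>p = \<tau>p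
              and s = s]) force+
      also have "\<dots> \<le> \<rho> * z" using \<rho>(1) z0 by (rule mult_right_mono)
      finally show ?thesis by (simp add: z_def)
    next
      case False
      \<comment> \<open>Without waiting the last schedule starts at some \<open>T > 0\<close>, so
        there is a previous schedule, whose step is unfolded next.\<close>
      have "0 \<le> z / (\<Theta> - 1)" using z0 \<Theta> by simp
      then have tT: "t = T" "0 < T" using wait False by auto
      show ?thesis
        using step(4)
      proof cases
        case init then show ?thesis using tT by simp
      next
        case (step T0 u D0 t1 x1 es1)
        define R1 where "R1 = released \<sigma> t1 - D0"
        define l where "l = min_duration c \<sigma> t1 u R1"
        have feas1: "feasible_schedule c \<sigma> t1 u R1 x1 es1" and T: "T = t1 + l"
          using step by (auto simp: optimal_schedule_def R1_def l_def)
        have R1: "finite R1" "R1 \<noteq> {}" "R1 \<subseteq> {..<length \<sigma>}" "\<And>i. i \<in> R1 \<Longrightarrow> release (\<sigma> ! i) \<le> t1"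
          using may_startD[OF step(6) \<Theta>(1)] by (auto simp: R1_def released_def)
        obtain s where s: "0 \<le> s" "s \<le> T0" "\<bar>u\<bar> \<le> (\<Theta> - 1) * s"
          "\<And>j. j < length \<sigma> \<Longrightarrow> j \<notin> D0 \<Longrightarrow> s \<le> release (\<sigma> ! j)"
          using smarterstart_state_invariant[OF step(4) c \<Theta>(1) \<sigma>] by blast
        obtain j where j: "j \<in> R1" "p = destination (\<sigma> ! j)"
          using feasible_last[OF feas1 R1(2)] step(2) by metis
        have j': "j \<in> {..<length \<sigma>}" "j \<notin> D0" using j(1) R1(3) by (auto simp: R1_def)
        obtain v \<tau>q where \<tau>q: "0 \<le> v" "v \<le> \<tau>q" "release (\<sigma> ! j) \<le> v" "\<tau>q \<le> z" "x \<tau>q = p"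
          using feasible_visit[OF feas j'(1)] j(2) unfolding z_def by metis
        obtain m \<tau>w where \<tau>w: "m \<in> R1" "0 \<le> \<tau>w" "\<tau>w \<le> z" "x \<tau>w = destination (\<sigma> ! m)"
          "l \<le> \<bar>u - 0\<bar> + (\<tau>w - 0)"
          using feasible_last_unload[OF feas R1(3,1,2,4), where p = u] unfolding z_def l_def by blast
        obtain v' where v': "t1 \<le> v'" "v' \<le> T" "x1 v' = destination (\<sigma> ! m)"
          using feasible_visit[OF feas1 \<tau>w(1)] step(1) by (metis order_trans)
        \<comment> \<open>\<open>i\<close> is unserved after the previous schedule, so it was not
          yet released at the start of that schedule.\<close>
        have "t1 \<le> release (\<sigma> ! i)" using iD step(3) by (auto simp: released_def)
        then have \<tau>1: "t1 \<le> \<tau>" using \<tau>(2) by simp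
        have "l \<le> \<bar>u - 0\<bar> + min_duration c \<sigma> t1 0 (released \<sigma> t1)"
          unfolding l_def
          by (rule min_duration_triangle) (use c R1 in \<open>auto simp: R1_def\<close>)
        then have l: "l \<le> \<bar>u\<bar> + (\<Theta> - 1) * t1" using may_startD[OF step(6) \<Theta>(1)] by simp
        have "C \<le> (3 * \<Theta>\<^sup>2 + 3) / (2 * \<Theta> + 1) * z"
        proof (rule not_waiting_bound[OF \<Theta>, where t = t1 and l = l and u = u and q = p and a = "x \<tau>"
              and w = "x \<tau>w" and s = s and \<tau>q = \<tau>q and \<tau>w = \<tau>w and \<tau>a = \<tau>])
          show "\<bar>x \<tau>w - u\<bar> + \<bar>x \<tau>w - p\<bar> \<le> l"
            using feasible_lipschitz[OF feas1, of v' t1] feasible_lipschitz[OF feas1, of v' T]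
              feasible_start[OF feas1] v' \<tau>w(4) step(1,2) T by simp
          show "s \<le> \<tau>q" using s(4)[of j] j' \<tau>q by auto
          show "0 \<le> t1" "s \<le> t1" using s(1,2) step(5) by auto
          show "\<bar>p - x \<tau>\<bar> \<le> \<bar>\<tau>q - \<tau>\<bar>" "\<bar>p\<bar> \<le> \<tau>q"
            using lip[of \<tau>q \<tau>] x_le[of \<tau>q] \<tau>q \<tau>(3) by simp_all
          show "\<bar>x \<tau>w - x \<tau>\<bar> \<le> \<bar>\<tau>w - \<tau>\<bar>" using lip \<tau>w(2) \<tau>(3) by simp
          show "C \<le> t1 + l + \<bar>p - x \<tau>\<bar> + (z - \<tau>)" using C tT(1) T \<tau>(5) by simp
          show "l \<le> \<bar>u\<bar> + \<tau>w" using \<tau>w(5) by simp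
        qed (fact l \<tau>1 \<tau>(4) \<tau>q(4) \<tau>w(3) s(3))+
        also have "\<dots> \<le> \<rho> * z" using \<rho>(2) z0 by (rule mult_right_mono)
        finally show ?thesis by (simp add: z_def)
      qed
    qed
  qed
qed

lemma smarterstart_le_Opt:
  assumes "1 \<le> c" "1 < \<Theta>" "\<Theta> \<le> 2" "dar_instance \<sigma>" "smarterstart_completion c \<Theta> \<sigma> C"
    and "(2 * \<Theta>\<^sup>2 - \<Theta> + 1) / (\<Theta>\<^sup>2 - 1) \<le> \<rho>" "(3 * \<Theta>\<^sup>2 + 3) / (2 * \<Theta> + 1) \<le> \<rho>"
  shows "C \<le> \<rho> * Opt c \<sigma>"
proof -
  obtain p where state: "smarterstart_state c \<Theta> \<sigma> C p {..<length \<sigma>}"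
    using assms(5) by (auto simp: smarterstart_completion_def)
  have "0 < (3 * \<Theta>\<^sup>2 + 3) / (2 * \<Theta> + 1)" using assms(2)
    by (intro divide_pos_pos) (auto intro: add_nonneg_pos)
  then have \<rho>: "0 < \<rho>" using assms(7) by linarith
  \<comment> \<open>With \<open>\<rho>\<close> moved to the left, the bound for each offline
    schedule passes to the infimum.\<close>
  have "C / \<rho> \<le> Opt c \<sigma>"
    unfolding Opt_def
  proof (rule min_duration_ge)
    fix x es assume "feasible_schedule c \<sigma> 0 0 {..<length \<sigma>} x es"
    from smarterstart_upper_bound[OF assms(1-4) state this assms(6,7)]
    show "C / \<rho> \<le> finish_time 0 es - 0" using \<rho> by (simp add: field_simps)
  qed (use assms(1) in auto)
  then show ?thesis using \<rho> by (simp add: field_simps)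
qed

section \<open>Lower bounds\<close>

lemma Opt_nonneg: "1 \<le> c \<Longrightarrow> 0 \<le> Opt c \<sigma>"
  unfolding Opt_def by (rule min_duration_ge) (auto dest: feasible_start_le_finish)

text \<open>Up to time \<open>1 / (\<Theta> - 1)\<close> only the request at 1 is known. A tour for
  it has length 1, so the waiting condition ends exactly then.\<close>

lemma first_start:
  assumes c: "1 \<le> c" and \<Theta>: "1 < \<Theta>" and \<sigma>: "\<sigma> = Request 1 1 0 # \<sigma>'"
    and late: "\<And>q. q \<in> set \<sigma>' \<Longrightarrow> 1 / (\<Theta> - 1) < release q"
    and t: "0 \<le> t" "may_start c \<Theta> \<sigma> {} t" "\<And>v. 0 \<le> v \<Longrightarrow> v < t \<Longrightarrow> \<not> may_start c \<Theta> \<sigma> {} v"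
    and opt: "optimal_schedule c \<sigma> t 0 (released \<sigma> t - {}) x es"
  shows "released \<sigma> t = {0} \<and> finish_time t es = 1 / (\<Theta> - 1) + 1 \<and> x (finish_time t es) = 1"
proof -
  define s where "s = 1 / (\<Theta> - 1)"
  have s: "(\<Theta> - 1) * s = 1" "0 < s" using \<Theta> by (auto simp: s_def)
  have rel: "released \<sigma> v = {0}" if "0 \<le> v" "v \<le> s" for v
  proof -
    have "i = 0" if "i < length \<sigma>" "release (\<sigma> ! i) \<le> v" for i
      using that late[of "\<sigma>' ! (i - 1)"] \<open>v \<le> s\<close> by (cases i) (auto simp: \<sigma> s_def)
    then show ?thesis using that(1) by (auto simp: released_def \<sigma>)
  qed
  have "reachable c \<sigma> v 0 {0} (v + 1) 1" if "0 \<le> v" for v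
    by (rule reachable_serve[OF reachable_start c, where g = "v + 1"]) (use that in \<open>auto simp: \<sigma>\<close>)
  then have L: "min_duration c \<sigma> v 0 {0} \<le> 1" if "0 \<le> v" for v
    using min_duration_le_reachable[of c \<sigma> v 0 "{0}" "v + 1" 1] that by simp
  have "may_start c \<Theta> \<sigma> {} s"
    using L[of s] s(2) \<Theta> rel[of s] by (simp add: may_start_def s_def not_less divide_right_mono)
  then have ts: "t \<le> s" using t(3)[of s] s(2) by linarith
  have R: "released \<sigma> t = {0}" using rel t(1) ts by simp
  have L1: "1 \<le> min_duration c \<sigma> t 0 {0}"
    using destination_le_min_duration[of "{0}" c 0 \<sigma> 0 t] c by (simp add: \<sigma>)
  then have "(\<Theta> - 1) * s \<le> (\<Theta> - 1) * t" using may_startD(2)[OF t(2) \<Theta>] R s(1) by simp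
  then have t_eq: "t = s" using ts \<Theta> by simp
  have feas: "feasible_schedule c \<sigma> t 0 {0} x es" and "finish_time t es - t = min_duration c \<sigma> t 0 {0}"
    using opt R by (auto simp: optimal_schedule_def)
  moreover from feasible_last[OF feas] have "x (finish_time t es) = 1" by (metis \<sigma> insert_not_empty
        nth_Cons_0 request.sel(2) singletonD)
  ultimately show ?thesis using R L1 L[OF t(1)] t_eq by (simp add: s_def)
qed

text \<open>As \<open>A\<close> is positive and \<open>Opt\<close> nonnegative,
  \<open>\<alpha>\<close> is positive, so \<open>Opt\<close> may be replaced by the duration
  \<open>B\<close> of any offline schedule.\<close>

lemma ratio_lower_bound:
  assumes "1 \<le> c" "implements_smarterstart c \<Theta> Alg" "dar_instance \<sigma>"
    and "\<And>\<sigma>. dar_instance \<sigma> \<Longrightarrow> Alg \<sigma> \<le> \<alpha> * Opt c \<sigma>"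
    and "\<And>C. smarterstart_completion c \<Theta> \<sigma> C \<Longrightarrow> A \<le> C" "0 < A"
    and "reachable c \<sigma> 0 0 {..<length \<sigma>} B q"
  shows "A \<le> \<alpha> * B"
proof -
  have A: "A \<le> \<alpha> * Opt c \<sigma>"
    using assms(2-5) unfolding implements_smarterstart_def by (meson order_trans)
  have O: "0 \<le> Opt c \<sigma>" "Opt c \<sigma> \<le> B"
    using Opt_nonneg[OF assms(1)] min_duration_le_reachable[OF assms(7)] by (auto simp: Opt_def)
  have "0 < \<alpha>"
    using A O(1) assms(6) by (smt (verit) mult_nonneg_nonpos mult.commute)
  then show ?thesis using A mult_left_mono[OF O(2), of \<alpha>] by linarith
qed

text \<open>Removes the delay \<open>d\<close> with which requests appear just after SmarterStart
  has started.\<close>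

lemma le_limit:
  fixes f g :: "real \<Rightarrow> real"
  assumes "0 < e" "\<And>d. 0 < d \<Longrightarrow> d < e \<Longrightarrow> f d \<le> g d" "isCont f 0" "isCont g 0"
  shows "f 0 \<le> g 0"
proof (rule tendsto_le[of "at_right 0" g "g 0" f "f 0"])
  show "(f \<longlongrightarrow> f 0) (at_right 0)" "(g \<longlongrightarrow> g 0) (at_right 0)"
    using assms(3,4) by (auto simp: isCont_def intro: filterlim_at_within_not_equal tendsto_within_subset)
  show "eventually (\<lambda>d. f d \<le> g d) (at_right 0)"
    using assms(1,2) by (auto simp: eventually_at_right_field)
qed simp

text \<open>A ride from \<open>-r\<close> to 1 is released at \<open>r\<close>, just after the first
  start. The offline server is at \<open>-r\<close> in time and finishes at
  \<open>2 * r + 1\<close>. SmarterStart ends its first schedule at 1, waits at least until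
  \<open>(2 * r + 1) * s\<close>, and then still needs \<open>2 * r + 2\<close>.\<close>

lemma waiting_lower_bound:
  assumes c: "1 \<le> c" and \<Theta>: "1 < \<Theta>" and impl: "implements_smarterstart c \<Theta> Alg"
    and ratio: "\<And>\<sigma>. dar_instance \<sigma> \<Longrightarrow> Alg \<sigma> \<le> \<alpha> * Opt c \<sigma>"
  shows "(2 * \<Theta>\<^sup>2 - \<Theta> + 1) / (\<Theta>\<^sup>2 - 1) \<le> \<alpha>"
proof -
  define s where "s = 1 / (\<Theta> - 1)"
  have s: "0 < s" using \<Theta> by (simp add: s_def)
  have bound: "(2 * r + 1) * s + 2 * r + 2 \<le> \<alpha> * (2 * r + 1)" if r: "s < r" for r
  proof -
    define \<sigma> where "\<sigma> = [Request 1 1 0, Request (-r) 1 r]"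
    have nth: "\<sigma> ! 0 = Request 1 1 0" "\<sigma> ! Suc 0 = Request (-r) 1 r" "length \<sigma> = 2" by (auto simp: \<sigma>_def)
    have sub: "released \<sigma> v \<subseteq> {0, 1}" for v by (auto simp: released_def nth)
    have rel0: "0 \<in> released \<sigma> v" if "0 \<le> v" for v using that by (auto simp: released_def nth)
    have inv: "T = 0 \<and> p = 0 \<and> D = {} \<or> T = s + 1 \<and> p = 1 \<and> D = {0} \<or>
      D = {0, 1} \<and> (2 * r + 1) * s + 2 * r + 2 \<le> T" if "smarterstart_state c \<Theta> \<sigma> T p D" for T p D
      using that
    proof induction
      case init then show ?case by simp
    next
      case (step T p D t x es)
      from step.IH consider "T = 0" "p = 0" "D = {}" | "T = s + 1" "p = 1" "D = {0}" | "D = {0, 1}"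
        by blast
      then show ?case
      proof cases
        case 1
        have *: "released \<sigma> t = {0} \<and> finish_time t es = 1 / (\<Theta> - 1) + 1 \<and> x (finish_time t es) = 1"
          by (rule first_start[OF c \<Theta>, of \<sigma> "[Request (-r) 1 r]"])
            (use 1 step r in \<open>auto simp: \<sigma>_def s_def\<close>)
        have "D \<union> (released \<sigma> t - D) = {0}" "finish_time t es = s + 1" "x (finish_time t es) = 1"
          using * 1(3) by (elim conjE, simp add: s_def)+
        then show ?thesis by blast
      next
        case 2
        have R: "released \<sigma> t = {0, 1}" "released \<sigma> t - D = {1}"
          using may_startD(1)[OF step.hyps(3) \<Theta>] sub[of t] rel0[of t] 2 step.hyps(2) s by auto
        have "2 * r + 1 \<le> min_duration c \<sigma> t 0 {0, 1}"
        proof (rule min_duration_ge[OF _ c])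
          fix y fs assume feas: "feasible_schedule c \<sigma> t 0 {0, 1} y fs"
          from feasible_trip[OF feas, of 1] obtain v w where
            "t \<le> v" "v \<le> w" "w \<le> finish_time t fs" "y v = - r" "y w = 1" by (auto simp: nth)
          then show "2 * r + 1 \<le> finish_time t fs - t"
            using feasible_lipschitz[OF feas, of t v] feasible_lipschitz[OF feas, of v w]
              feasible_start[OF feas] by simp
        qed simp
        then have "2 * r + 1 \<le> (\<Theta> - 1) * t" using may_startD(2)[OF step.hyps(3) \<Theta>] R by simp
        then have t: "(2 * r + 1) * s \<le> t" using \<Theta> by (simp add: s_def field_simps)
        have feas: "feasible_schedule c \<sigma> t 1 {1} x es" using step 2 R by (simp add: optimal_schedule_def)
        from feasible_trip[OF feas, of 1] obtain v w where
          "t \<le> v" "v \<le> w" "w \<le> finish_time t es" "x v = - r" "x w = 1" by (auto simp: nth)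
        then have "2 * r + 2 \<le> finish_time t es - t"
          using feasible_lipschitz[OF feas, of t v] feasible_lipschitz[OF feas, of v w]
            feasible_start[OF feas] by simp
        then show ?thesis using t 2 R by auto
      next
        case 3
        then show ?thesis using may_startD(1)[OF step.hyps(3) \<Theta>] sub[of t] by blast
      qed
    qed
    show ?thesis
    proof (rule ratio_lower_bound[OF c impl _ ratio])
      show "dar_instance \<sigma>" using r s by (auto simp: dar_instance_def \<sigma>_def)
      fix C assume "smarterstart_completion c \<Theta> \<sigma> C"
      then obtain p where "smarterstart_state c \<Theta> \<sigma> C p {0, 1}"
        by (auto simp: smarterstart_completion_def nth lessThan_nat_numeral numeral_2_eq_2 lessThan_Suc insert_commute)
      from inv[OF this] show "(2 * r + 1) * s + 2 * r + 2 \<le> C" by auto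
    next
      show "0 < (2 * r + 1) * s + 2 * r + 2" using r s by (simp add: add_pos_pos)
      have "reachable c \<sigma> 0 0 {1} (2 * r + 1) 1"
        by (rule reachable_serve[OF reachable_start c, where g = r]) (use r s in \<open>auto simp: nth\<close>)
      then have "reachable c \<sigma> 0 0 {0, 1} (2 * r + 1) 1"
        by (rule reachable_serve[OF _ c, where g = "2 * r + 1"]) (use r s in \<open>auto simp: nth\<close>)
      then show "reachable c \<sigma> 0 0 {..<length \<sigma>} (2 * r + 1) 1"
        by (simp add: nth numeral_2_eq_2 lessThan_Suc insert_commute)
    qed
  qed
  \<comment> \<open>The zeros keep the shape of the two functions of \<open>d\<close> whose limit is
    taken.\<close>
  have "(2 * (s + 0) + 1) * s + 2 * (s + 0) + 2 \<le> \<alpha> * (2 * (s + 0) + 1)"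
    by (rule le_limit[of 1 "\<lambda>d. (2 * (s + d) + 1) * s + 2 * (s + d) + 2" "\<lambda>d. \<alpha> * (2 * (s + d) + 1)"])
      (use bound[of "s + d" for d] in \<open>auto intro!: continuous_intros simp del: distrib_left_numeral\<close>)
  then have "(s + 1) + 1 / (2 * s + 1) \<le> \<alpha>" using s by (simp add: field_simps)
  moreover have "(s + 1) + 1 / (2 * s + 1) = (2 * \<Theta>\<^sup>2 - \<Theta> + 1) / (\<Theta>\<^sup>2 - 1)"
  proof -
    have "2 * s + 1 = (\<Theta> + 1) / (\<Theta> - 1)" using \<Theta> by (simp add: s_def field_simps)
    moreover have "\<Theta>\<^sup>2 - 1 = (\<Theta> - 1) * (\<Theta> + 1)" by (simp add: power2_eq_square algebra_simps)
    ultimately show ?thesis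
      using \<Theta> by (simp add: s_def divide_simps power2_eq_square) (simp add: algebra_simps)
  qed
  ultimately show ?thesis by simp
qed

section \<open>Instances that force three schedules\<close>

text \<open>Common frame for the two remaining instances. SmarterStart starts at \<open>s\<close>
  and at \<open>t2\<close>; \<open>m\<close> is the rightmost point of the first three requests, and
  \<open>K\<close> is the length of the tour from 1 that takes the ride first and ends at
  \<open>-r\<close>. \<open>K < 1 + 2 * r + \<beta>\<close> and
  \<open>\<beta> < 2 * \<alpha> + r\<close> make the two other orders longer.
  \<open>1 \<le> \<alpha> \<or> \<beta> \<le> 1\<close> allows the request at 1 to be served before
  or after the ride, and by \<open>r' \<le> 2 * r + a\<close> the offline server finds the last
  request released on arrival.\<close>

locale three_phases =
  fixes c :: enat and \<Theta> s r \<alpha> \<beta> a r' m t2 K :: real and \<sigma> :: "request list"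
  assumes c: "1 \<le> c" and \<Theta>: "1 < \<Theta>" and s_def: "s = 1 / (\<Theta> - 1)" and r: "s < r" "r \<le> s + 1" "r \<le> m"
    and m: "m = max 1 \<beta>" and ride: "- r \<le> \<alpha>" "\<alpha> \<le> \<beta>" "1 \<le> \<alpha> \<or> \<beta> \<le> 1"
    and t2: "t2 = max (s + 1) ((2 * r + m) * s)" "t2 < r'"
    and K: "K = \<bar>1 - \<alpha>\<bar> + (\<beta> - \<alpha>) + (\<beta> + r)" "K < 1 + 2 * r + \<beta>" "\<beta> < 2 * \<alpha> + r"
    and a: "m \<le> a" "r' \<le> 2 * r + a"
    and \<sigma>_def: "\<sigma> = [Request 1 1 0, Request (-r) (-r) r, Request \<alpha> \<beta> r, Request a a r']"
begin

lemma nth: "\<sigma> ! 0 = Request 1 1 0" "\<sigma> ! Suc 0 = Request (-r) (-r) r" "\<sigma> ! 2 = Request \<alpha> \<beta> r"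
  "\<sigma> ! 3 = Request a a r'" "length \<sigma> = 4"
  by (auto simp: \<sigma>_def)

lemma less_length: "i < length \<sigma> \<longleftrightarrow> i = 0 \<or> i = 1 \<or> i = 2 \<or> i = 3"
  by (auto simp: nth)

lemma all_requests: "{..<length \<sigma>} = {0, 1, 2, 3}"
  unfolding set_eq_iff lessThan_iff less_length by simp

lemma s_pos: "0 < s" "0 < r"
proof -
  show "0 < s" using \<Theta> by (simp add: s_def)
  then show "0 < r" using r by simp
qed

lemma released_eq: "t2 < t \<or> r \<le> t \<Longrightarrow> t < r' \<Longrightarrow> released \<sigma> t = {0, 1, 2}"
  using s_pos r t2 by (auto simp: released_def less_length nth(1-4))

lemma released_late: "r' \<le> t \<Longrightarrow> released \<sigma> t = {0, 1, 2, 3}"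
  using s_pos r t2 by (auto simp: released_def less_length nth(1-4))

text \<open>The tour visits \<open>-r\<close> first, not before time \<open>r\<close>, so that
  everything it serves is released by then. It then sweeps to the right.\<close>

lemma reachable_m: "0 \<le> v \<Longrightarrow> reachable c \<sigma> v 0 {0, 1, 2} (v + 2 * r + m) m"
proof -
  assume v: "0 \<le> v"
  have 1: "reachable c \<sigma> v 0 {1} (v + r) (- r)"
    by (rule reachable_serve[OF reachable_start c, where g = "v + r"]) (use v s_pos in \<open>auto simp: nth\<close>)
  show ?thesis
  proof (cases "1 \<le> \<alpha>")
    case True
    have "reachable c \<sigma> v 0 {0, 1} (v + 2 * r + 1) 1"
      by (rule reachable_serve[OF 1 c, where g = "v + 2 * r + 1"]) (use v s_pos in \<open>auto simp: nth\<close>)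
    then have "reachable c \<sigma> v 0 {2, 0, 1} (v + 2 * r + \<beta>) \<beta>"
      by (rule reachable_serve[OF _ c, where g = "v + 2 * r + \<alpha>"]) (use v s_pos True ride in \<open>auto simp: nth\<close>)
    then show ?thesis using True ride by (simp add: m insert_commute)
  next
    case False
    have "reachable c \<sigma> v 0 {2, 1} (v + 2 * r + \<beta>) \<beta>"
      by (rule reachable_serve[OF 1 c, where g = "v + 2 * r + \<alpha>"]) (use v s_pos ride in \<open>auto simp: nth\<close>)
    then have "reachable c \<sigma> v 0 {0, 2, 1} (v + 2 * r + 1) 1"
      by (rule reachable_serve[OF _ c, where g = "v + 2 * r + 1"]) (use v s_pos False ride in \<open>auto simp: nth\<close>)
    then show ?thesis using False ride by (simp add: m insert_commute)
  qed
qed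

lemma reachable_all: "reachable c \<sigma> 0 0 {..<length \<sigma>} (2 * r + a) a"
proof -
  have "reachable c \<sigma> 0 0 {3, 0, 1, 2} (2 * r + a) a"
    by (rule reachable_serve[OF reachable_m c, where g = "2 * r + a"]) (use a in \<open>auto simp: nth\<close>)
  then show ?thesis by (simp add: all_requests insert_commute)
qed

text \<open>Both ends \<open>-r\<close> and \<open>m\<close> have to be visited, and
  \<open>r \<le> m\<close> makes the left end the cheaper one to visit first.\<close>

lemma min_duration_m:
  assumes "0 \<le> t"
  shows "min_duration c \<sigma> t 0 {0, 1, 2} = 2 * r + m"
proof (rule antisym)
  show "min_duration c \<sigma> t 0 {0, 1, 2} \<le> 2 * r + m"
    using min_duration_le_reachable[OF reachable_m[OF assms]] by simp
  show "2 * r + m \<le> min_duration c \<sigma> t 0 {0, 1, 2}"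
  proof (rule min_duration_ge[OF _ c])
    fix x es assume feas: "feasible_schedule c \<sigma> t 0 {0, 1, 2} x es"
    obtain v where v: "t \<le> v" "v \<le> finish_time t es" "x v = - r"
      using feasible_trip[OF feas, of 1] by (auto simp: nth)
    obtain w0 where w0: "t \<le> w0" "w0 \<le> finish_time t es" "x w0 = 1"
      using feasible_trip[OF feas, of 0] by (auto simp: nth)
    obtain v2 w2 where w2: "t \<le> v2" "v2 \<le> w2" "w2 \<le> finish_time t es" "x w2 = \<beta>"
      using feasible_trip[OF feas, of 2] by (auto simp: nth)
    obtain w where w: "t \<le> w" "w \<le> finish_time t es" "x w = m"
      using w0 w2 unfolding m by (metis max_def order_trans)
    show "2 * r + m \<le> finish_time t es - t"
      using feasible_lipschitz[OF feas, of v t] feasible_lipschitz[OF feas, of w t]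
        feasible_lipschitz[OF feas, of w v] feasible_start[OF feas] v w r s_pos by simp
  qed simp
qed

text \<open>The last action is a delivery at \<open>-r\<close> or at \<open>\<beta>\<close>. Ending
  at \<open>\<beta>\<close> would take longer than \<open>K\<close>, whether \<open>-r\<close> is
  visited before or after the pickup at \<open>\<alpha>\<close>.\<close>

lemma second_schedule:
  assumes "r \<le> t" and opt: "optimal_schedule c \<sigma> t 1 {1, 2} x es"
  shows "finish_time t es = t + K" "x (finish_time t es) = - r"
proof -
  let ?f = "finish_time t es"
  have feas: "feasible_schedule c \<sigma> t 1 {1, 2} x es" and f: "?f - t = min_duration c \<sigma> t 1 {1, 2}"
    using opt by (auto simp: optimal_schedule_def)
  have "reachable c \<sigma> t 1 {2} (t + \<bar>1 - \<alpha>\<bar> + (\<beta> - \<alpha>)) \<beta>"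
    by (rule reachable_serve[OF reachable_start c, where g = "t + \<bar>1 - \<alpha>\<bar>"])
      (use assms(1) ride in \<open>auto simp: nth\<close>)
  then have "reachable c \<sigma> t 1 {1, 2} (t + K) (- r)"
    by (rule reachable_serve[OF _ c, where g = "t + K"]) (use assms(1) ride in \<open>auto simp: nth K\<close>)
  from min_duration_le_reachable[OF this] have le: "?f - t \<le> K" using f by simp
  note lip = feasible_lipschitz[OF feas]
  have xt: "x t = 1" by (rule feasible_start[OF feas])
  obtain v where v: "t \<le> v" "v \<le> ?f" "x v = - r"
    using feasible_trip[OF feas, of 1] by (auto simp: nth)
  obtain w w' where w: "t \<le> w" "w \<le> w'" "w' \<le> ?f" "x w = \<alpha>" "x w' = \<beta>"
    using feasible_trip[OF feas, of 2] by (auto simp: nth)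
  obtain i where i: "i \<in> {1, 2}" "x ?f = destination (\<sigma> ! i)"
    using feasible_last[OF feas] by blast
  have "x ?f \<noteq> \<beta>"
  proof
    assume b: "x ?f = \<beta>"
    show False
    proof (cases "w \<le> v")
      case True
      have "\<bar>1 - \<alpha>\<bar> \<le> w - t" "\<alpha> + r \<le> v - w" "r + \<beta> \<le> ?f - v"
        using lip[of t w] lip[of w v] lip[of v ?f] xt b v w True by auto
      then show False using le K by linarith
    next
      case False
      have "1 + r \<le> v - t" "\<alpha> + r \<le> w - v" "\<beta> - \<alpha> \<le> ?f - w"
        using lip[of t v] lip[of v w] lip[of w ?f] xt b v w False by auto
      then show False using le K by linarith
    qed
  qed
  then show q: "x ?f = - r" using i by (auto simp: nth)
  have "\<bar>1 - \<alpha>\<bar> \<le> w - t" "\<beta> - \<alpha> \<le> w' - w" "\<beta> + r \<le> ?f - w'"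
    using lip[of t w] lip[of w w'] lip[of w' ?f] xt q w by auto
  then show "?f = t + K" using le K(1) by linarith
qed

text \<open>One disjunct per number of completed schedules. The second start is at
  \<open>t2\<close>, before the release of the last request, so the server is led to
  \<open>-r\<close> and then has to cross the distance \<open>r + a\<close>.\<close>

lemma state_cases:
  assumes "smarterstart_state c \<Theta> \<sigma> T p D"
  shows "T = 0 \<and> p = 0 \<and> D = {} \<or> T = s + 1 \<and> p = 1 \<and> D = {0} \<or>
    T = t2 + K \<and> p = - r \<and> D = {0, 1, 2} \<or> D = {0, 1, 2, 3} \<and> t2 + K + r + a \<le> T"
  using assms
proof induction
  case init then show ?case by simp
next
  case (step T p D t x es)
  have sub: "released \<sigma> t \<subseteq> {0, 1, 2, 3}" by (auto simp: released_def less_length)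
  note ne = may_startD(1)[OF step.hyps(3) \<Theta>] and L = may_startD(2)[OF step.hyps(3) \<Theta>]
  from step.IH consider "T = 0" "p = 0" "D = {}" | "T = s + 1" "p = 1" "D = {0}"
    | "T = t2 + K" "p = - r" "D = {0, 1, 2}" | "D = {0, 1, 2, 3}" by blast
  then show ?case
  proof cases
    case 1
    have *: "released \<sigma> t = {0} \<and> finish_time t es = 1 / (\<Theta> - 1) + 1 \<and> x (finish_time t es) = 1"
      by (rule first_start[OF c \<Theta> \<sigma>_def]) (use 1 step r t2 in \<open>auto simp: s_def\<close>)
    have "D \<union> (released \<sigma> t - D) = {0}" "finish_time t es = s + 1" "x (finish_time t es) = 1"
      using * 1(3) by (elim conjE, simp add: s_def)+
    then show ?thesis by blast
  next
    case 2
    have t0: "r \<le> t2" "0 \<le> t2" "s + 1 \<le> t2" using t2 r s_pos by auto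
    have "may_start c \<Theta> \<sigma> D t2"
      using min_duration_m[OF t0(2)] released_eq[of t2] t0 t2 2
      by (auto simp: may_start_def not_less s_def)
    then have tt: "t \<le> t2" using step.hyps(4)[of t2] 2(1) t0 by linarith
    have rt: "r \<le> t" "0 \<le> t" using step.hyps(2) 2 r s_pos by auto
    have R: "released \<sigma> t = {0, 1, 2}" "released \<sigma> t - D = {1, 2}"
      using released_eq[of t] rt tt t2 2 by auto
    have "(2 * r + m) * s \<le> t"
      using L min_duration_m[OF rt(2)] R \<Theta> by (simp add: s_def field_simps)
    then have t: "t = t2" using tt step.hyps(2) 2 t2(1) by simp
    show ?thesis
      using second_schedule[OF rt(1), of x es] step.hyps(5) R 2 t by (simp add: insert_commute)
  next
    case 3
    have "r' \<le> t"
    proof (rule ccontr)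
      assume "\<not> ?thesis"
      moreover have "0 \<le> K" unfolding K using ride by linarith
      then have "r \<le> t" using 3(1) step.hyps(2) t2(1) r(2) by linarith
      ultimately show False using ne released_eq[of t] 3(3) by simp
    qed
    then have R: "released \<sigma> t = {0, 1, 2, 3}" "released \<sigma> t - D = {3}" using released_late 3 by auto
    have "optimal_schedule c \<sigma> t (- r) {3} x es" using step.hyps(5) 3 R by simp
    then have feas: "feasible_schedule c \<sigma> t (- r) {3} x es" by (simp add: optimal_schedule_def)
    have "\<bar>a - (- r)\<bar> \<le> finish_time t es - t"
      using destination_le_min_duration[of "{3}" c 3 \<sigma> "- r" t] min_duration_le[OF feas] c by (simp add: nth)
    then have "t2 + K + r + a \<le> finish_time t es" using 3(1) step.hyps(2) by linarith
    moreover have "D \<union> (released \<sigma> t - D) = {0, 1, 2, 3}" by (subst R(2)) (simp add: 3(3) insert_commute)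
    ultimately show ?thesis by blast
  next
    case 4
    then show ?thesis using ne sub by blast
  qed
qed

lemma ratio_bound:
  assumes "implements_smarterstart c \<Theta> Alg"
    and "\<And>\<sigma>. dar_instance \<sigma> \<Longrightarrow> Alg \<sigma> \<le> \<rho> * Opt c \<sigma>"
  shows "t2 + K + r + a \<le> \<rho> * (2 * r + a)"
proof (rule ratio_lower_bound[OF c assms(1) _ assms(2) _ _ reachable_all])
  show "dar_instance \<sigma>" using s_pos t2 by (auto simp: dar_instance_def \<sigma>_def)
  show "0 < t2 + K + r + a" using s_pos t2 K ride a m by auto
  fix C assume "smarterstart_completion c \<Theta> \<sigma> C"
  then obtain p D where D: "smarterstart_state c \<Theta> \<sigma> C p D" "3 \<in> D"
    unfolding smarterstart_completion_def all_requests by blast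
  from state_cases[OF D(1)] show "t2 + K + r + a \<le> C" using D(2) by (elim disjE) auto
qed

end


section \<open>The three-schedule instances for small and for large parameters\<close>

lemma not_waiting_lower_bound:
  assumes c: "1 \<le> c" and \<Theta>: "1 < \<Theta>" "\<Theta> \<le> 2" and impl: "implements_smarterstart c \<Theta> Alg"
    and ratio: "\<And>\<sigma>. dar_instance \<sigma> \<Longrightarrow> Alg \<sigma> \<le> \<rho> * Opt c \<sigma>"
  shows "(3 * \<Theta>\<^sup>2 + 3) / (2 * \<Theta> + 1) \<le> \<rho>"
proof -
  define s where "s = 1 / (\<Theta> - 1)"
  have s: "1 \<le> s" using \<Theta> by (simp add: s_def)
  have bound: "2 * ((2 * (s + d) + (s + 2)) * s) + 2 * s + 3 + d \<le> \<rho> * ((2 * (s + d) + (s + 2)) * s + d)"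
    if d: "0 < d" "d < 1" for d
  proof -
    define r where "r = s + d"
    \<comment> \<open>The largest stop for which, with every \<open>r > s\<close>, going from 1 to
      \<open>y\<close> and then to \<open>-r\<close> is shorter than going to \<open>-r\<close>
      first: \<open>2 * y - 1 + r < 1 + 2 * r + y\<close>.\<close>
    define y where "y = s + 2"
    define t2 where "t2 = (2 * r + y) * s"
    \<comment> \<open>By \<open>s \<ge> 1\<close> the second start is not before the offline server
      completes its tour at \<open>y\<close>, which leaves room for a last request to the
      right.\<close>
    have t2: "2 * r + y \<le> t2" using s d by (simp add: t2_def r_def y_def mult_le_cancel_left1)
    then have "s + 1 \<le> t2" using s d by (simp add: r_def y_def)
    then have t2_max: "t2 = max (s + 1) ((2 * r + y) * s)" by (simp add: t2_def)
    \<comment> \<open>The last request appears at time \<open>t2 + d\<close> exactly where the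
      offline server, moving on to the right, is at that time.\<close>
    interpret three_phases c \<Theta> s r y y "t2 + d - 2 * r" "t2 + d" y t2 "2 * y - 1 + r"
      "[Request 1 1 0, Request (-r) (-r) r, Request y y r, Request (t2 + d - 2 * r) (t2 + d - 2 * r) (t2 + d)]"
      by unfold_locales (rule c \<Theta>(1) s_def t2_max | use s d t2 in \<open>simp add: r_def y_def\<close>)+
    show ?thesis using ratio_bound[OF impl ratio] by (simp add: r_def y_def t2_def algebra_simps)
  qed
  have "2 * ((2 * (s + 0) + (s + 2)) * s) + 2 * s + 3 + 0 \<le> \<rho> * ((2 * (s + 0) + (s + 2)) * s + 0)"
    by (rule le_limit[of 1 "\<lambda>d. 2 * ((2 * (s + d) + (s + 2)) * s) + 2 * s + 3 + d"
          "\<lambda>d. \<rho> * ((2 * (s + d) + (s + 2)) * s + d)"])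
      (use bound in \<open>auto intro!: continuous_intros\<close>)
  then have "2 * s + 3 \<le> (\<rho> - 2) * ((3 * s + 2) * s)" by (simp add: algebra_simps)
  moreover have "0 < (3 * s + 2) * s" using s by simp
  ultimately have "(2 * s + 3) / ((3 * s + 2) * s) \<le> \<rho> - 2" by (simp only: pos_divide_le_eq)
  then have "2 + (2 * s + 3) / ((3 * s + 2) * s) \<le> \<rho>" by simp
  moreover have "2 + (2 * s + 3) / ((3 * s + 2) * s) = (3 * \<Theta>\<^sup>2 + 3) / (2 * \<Theta> + 1)"
  proof -
    have "3 * s + 2 = (2 * \<Theta> + 1) / (\<Theta> - 1)" "2 * s + 3 = (3 * \<Theta> - 1) / (\<Theta> - 1)"
      using \<Theta> by (auto simp: s_def field_simps)
    then show ?thesis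
      using \<Theta> by (simp add: s_def divide_simps power2_eq_square) (simp add: algebra_simps)
  qed
  ultimately show ?thesis by simp
qed

text \<open>For \<open>s < 1\<close> the offline server is still on its way to 1 at the second
  start, so the last request can be placed at 1. The ratio is at least
  \<open>2 + max (s + 1) ((2 * s + 1) * s) / (2 * s + 1)\<close>, which is smallest at
  \<open>s = 1 / sqrt 2\<close>; \<open>27 / 10\<close> is slightly below that minimum and still
  above \<open>rho_star\<close>.\<close>

lemma large_parameter_lower_bound:
  assumes c: "1 \<le> c" and \<Theta>: "2 < \<Theta>" and impl: "implements_smarterstart c \<Theta> Alg"
    and ratio: "\<And>\<sigma>. dar_instance \<sigma> \<Longrightarrow> Alg \<sigma> \<le> \<rho> * Opt c \<sigma>"
  shows "27 / 10 \<le> \<rho>"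
proof -
  define s where "s = 1 / (\<Theta> - 1)"
  have s: "0 < s" "s < 1" using \<Theta> by (auto simp: s_def)
  define t where "t d = max (s + 1) ((2 * (s + d) + 1) * s)" for d
  have bound: "t d + 2 + 4 * s + 2 * d \<le> \<rho> * (2 * (s + d) + 1)" if d: "0 < d" "d < 1 - s" for d
  proof -
    define r where "r = s + d"
    have "1 - s \<le> (2 * r + 1) * (1 - s)" using s d by (simp add: r_def mult_le_cancel_right1)
    then have t2: "t d + d \<le> 2 * r + 1" using d s by (auto simp: t_def r_def algebra_simps)
    interpret three_phases c \<Theta> s r 0 s 1 "t d + d" 1 "t d" "1 + 2 * s + r"
      "[Request 1 1 0, Request (-r) (-r) r, Request 0 s r, Request 1 1 (t d + d)]"
      by unfold_locales (use c \<Theta> s d t2 in \<open>auto simp: s_def[symmetric] r_def t_def\<close>)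
    show ?thesis using ratio_bound[OF impl ratio] by (simp add: r_def algebra_simps)
  qed
  have "t 0 + 2 + 4 * s + 2 * 0 \<le> \<rho> * (2 * (s + 0) + 1)"
    by (rule le_limit[of "1 - s" "\<lambda>d. t d + 2 + 4 * s + 2 * d" "\<lambda>d. \<rho> * (2 * (s + d) + 1)"])
      (use bound s in \<open>auto simp: t_def intro!: continuous_intros\<close>)
  moreover have "7 / 10 * (2 * s + 1) \<le> t 0"
  proof (cases "s \<le> 7 / 10")
    case False
    then have "7 / 10 * (2 * s + 1) \<le> s * (2 * s + 1)" by (intro mult_right_mono) auto
    then show ?thesis by (simp add: t_def le_max_iff_disj mult.commute)
  qed (simp add: t_def le_max_iff_disj)
  ultimately have "27 / 10 * (2 * s + 1) \<le> \<rho> * (2 * s + 1)" by simp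
  then show ?thesis by (rule mult_right_le_imp_le) (use s in simp)
qed

section \<open>The optimal parameter\<close>

text \<open>The difference of the two sides of the equation after clearing denominators.\<close>

definition balance :: "real \<Rightarrow> real" where
  "balance \<Theta> = 3 * \<Theta>^4 - 4 * \<Theta>^3 - \<Theta> - 4"

lemma balance_iff:
  assumes "1 < \<Theta>"
  shows "(3 * \<Theta>\<^sup>2 + 3) / (2 * \<Theta> + 1) = (2 * \<Theta>\<^sup>2 - \<Theta> + 1) / (\<Theta>\<^sup>2 - 1) \<longleftrightarrow> balance \<Theta> = 0"
proof -
  have "\<Theta>\<^sup>2 - 1 \<noteq> 0" "2 * \<Theta> + 1 \<noteq> 0" using assms by (auto simp: power2_eq_1_iff)
  then have "(3 * \<Theta>\<^sup>2 + 3) / (2 * \<Theta> + 1) = (2 * \<Theta>\<^sup>2 - \<Theta> + 1) / (\<Theta>\<^sup>2 - 1) \<longleftrightarrow>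
    (3 * \<Theta>\<^sup>2 + 3) * (\<Theta>\<^sup>2 - 1) = (2 * \<Theta>\<^sup>2 - \<Theta> + 1) * (2 * \<Theta> + 1)"
    by (simp add: frac_eq_eq)
  also have "\<dots> \<longleftrightarrow> balance \<Theta> = 0"
    unfolding balance_def by (simp add: algebra_simps power2_eq_square power3_eq_cube power4_eq_xxxx)
  finally show ?thesis .
qed

text \<open>Rules out solutions to the right of the one found. In the difference quotient the cubic
  terms are at least \<open>51 / 5 * (x * x + y * y)\<close>, the quadratic ones at most
  \<open>6 * (x * x + y * y)\<close>.\<close>

lemma balance_strict_mono:
  assumes "17 / 10 \<le> x" "x < y"
  shows "balance x < balance y"
proof -
  have "balance y - balance x =
    (y - x) * (3 * (y^3 + y\<^sup>2 * x + y * x\<^sup>2 + x^3) - 4 * (y\<^sup>2 + y * x + x\<^sup>2) - 1)"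
    unfolding balance_def by (simp add: algebra_simps power2_eq_square power3_eq_cube power4_eq_xxxx)
  moreover have "0 < (y - x) * (3 * (y^3 + y\<^sup>2 * x + y * x\<^sup>2 + x^3) - 4 * (y\<^sup>2 + y * x + x\<^sup>2) - 1)"
  proof (rule mult_pos_pos)
    have "17 / 10 * y\<^sup>2 \<le> y * y\<^sup>2" "17 / 10 * y\<^sup>2 \<le> x * y\<^sup>2" "17 / 10 * x\<^sup>2 \<le> y * x\<^sup>2" "17 / 10 * x\<^sup>2 \<le> x * x\<^sup>2"
      using assms by (auto intro: mult_right_mono)
    moreover have "17 / 10 * (17 / 10) \<le> x * x" using assms by (intro mult_mono) auto
    moreover have "17 / 10 * (17 / 10) \<le> y * y" using assms by (intro mult_mono) auto
    moreover have "2 * (y * x) \<le> y * y + x * x" using sum_squares_bound[of y x] by (simp add: power2_eq_square)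
    ultimately show "0 < 3 * (y^3 + y\<^sup>2 * x + y * x\<^sup>2 + x^3) - 4 * (y\<^sup>2 + y * x + x\<^sup>2) - 1"
      by (simp add: power2_eq_square power3_eq_cube algebra_simps)
  qed (use assms in simp)
  ultimately show ?thesis by linarith
qed

lemma Theta_star:
  shows Theta_star_bounds: "1.71248 < Theta_star" "Theta_star < 1.7125"
    and Theta_star_eq: "rho_star = (2 * Theta_star\<^sup>2 - Theta_star + 1) / (Theta_star\<^sup>2 - 1)"
proof -
  \<comment> \<open>The sign changes on an interval of length 0.00002, short enough for the stated
    accuracy of both constants.\<close>
  have lo: "balance 1.71248 < 0" and hi: "0 < balance 1.7125"
    by (simp_all add: balance_def power2_eq_square power3_eq_cube power4_eq_xxxx)
  have "\<exists>x\<ge>1.71248. x \<le> 1.7125 \<and> balance x = 0"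
    by (rule IVT') (use lo hi in \<open>auto simp: balance_def intro!: continuous_intros\<close>)
  then obtain x where x: "1.71248 \<le> x" "x \<le> 1.7125" "balance x = 0" by blast
  have x': "1.71248 < x" "x < 1.7125" using x lo hi by (metis less_irrefl order_le_less)+
  have "Theta_star = x"
    unfolding Theta_star_def
  proof (rule Greatest_equality)
    have "x\<^sup>2 \<noteq> 1" using x by (auto simp: power2_eq_1_iff)
    then show "2 * x + 1 \<noteq> 0 \<and> x\<^sup>2 - 1 \<noteq> 0 \<and> (3 * x\<^sup>2 + 3) / (2 * x + 1) = (2 * x\<^sup>2 - x + 1) / (x\<^sup>2 - 1)"
      using balance_iff[of x] x by simp
    fix y :: real assume y: "2 * y + 1 \<noteq> 0 \<and> y\<^sup>2 - 1 \<noteq> 0 \<and>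
      (3 * y\<^sup>2 + 3) / (2 * y + 1) = (2 * y\<^sup>2 - y + 1) / (y\<^sup>2 - 1)"
    show "y \<le> x"
    proof (rule ccontr)
      assume "\<not> y \<le> x"
      then show False using balance_strict_mono[of x y] balance_iff[of y] x y by simp
    qed
  qed
  then show "1.71248 < Theta_star" "Theta_star < 1.7125"
    "rho_star = (2 * Theta_star\<^sup>2 - Theta_star + 1) / (Theta_star\<^sup>2 - 1)"
    using x' x balance_iff[of x] by (auto simp: rho_star_def)
qed

lemma rho_star_bounds: "\<bar>rho_star - 2.6662\<bar> < 0.00005"
proof -
  let ?\<Theta> = Theta_star
  have "1.71248\<^sup>2 \<le> ?\<Theta>\<^sup>2" "?\<Theta>\<^sup>2 \<le> 1.7125\<^sup>2"
    using Theta_star_bounds by (auto intro!: power_mono)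
  then have "2.66616 * (2 * ?\<Theta> + 1) < 3 * ?\<Theta>\<^sup>2 + 3" "3 * ?\<Theta>\<^sup>2 + 3 < 2.66624 * (2 * ?\<Theta> + 1)"
    using Theta_star_bounds by (simp_all add: power2_eq_square)
  then have "2.66616 < rho_star" "rho_star < 2.66624"
    using Theta_star_bounds by (auto simp: rho_star_def field_simps)
  then show ?thesis unfolding abs_less_iff by simp
qed

section \<open>Monotonicity of the two ratios and the best parameter\<close>

lemma waiting_ratio_antimono:
  fixes x y :: real
  assumes "1 < x" "x \<le> y" "y \<le> 2"
  shows "(2 * y\<^sup>2 - y + 1) / (y\<^sup>2 - 1) \<le> (2 * x\<^sup>2 - x + 1) / (x\<^sup>2 - 1)"
proof -
  \<comment> \<open>In this form the numerator decreases and the denominator increases.\<close>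
  have split: "(2 * z\<^sup>2 - z + 1) / (z\<^sup>2 - 1) = 2 + (3 - z) / (z\<^sup>2 - 1)" if "1 < z" for z :: real
  proof -
    have "z\<^sup>2 - 1 \<noteq> 0" using that by (auto simp: power2_eq_1_iff)
    then show ?thesis by (simp add: field_simps)
  qed
  have "1 < x\<^sup>2" using assms(1) by simp
  moreover have "x\<^sup>2 \<le> y\<^sup>2" using assms by (intro power_mono) auto
  ultimately have "(3 - y) / (y\<^sup>2 - 1) \<le> (3 - x) / (x\<^sup>2 - 1)" using assms by (intro frac_le) auto
  then show ?thesis using split assms by simp
qed

lemma not_waiting_ratio_mono:
  fixes x y :: real
  assumes "1 < x" "x \<le> y"
  shows "(3 * x\<^sup>2 + 3) / (2 * x + 1) \<le> (3 * y\<^sup>2 + 3) / (2 * y + 1)"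
proof -
  \<comment> \<open>The cross-multiplied difference of the two ratios, factored.\<close>
  have "0 \<le> (y - x) * (6 * x * y + 3 * (x + y) - 6)"
    using assms mult_mono[of 1 x 1 y] by (intro mult_nonneg_nonneg) auto
  then have "(3 * x\<^sup>2 + 3) * (2 * y + 1) \<le> (3 * y\<^sup>2 + 3) * (2 * x + 1)"
    by (simp add: algebra_simps power2_eq_square)
  then show ?thesis using assms by (simp add: divide_le_eq le_divide_eq field_simps)
qed

theorem theorem1p2:
  fixes c :: enat and Alg :: "real \<Rightarrow> request list \<Rightarrow> real"
  assumes "1 \<le> c"
    and "\<And>\<Theta>. 1 < \<Theta> \<Longrightarrow> implements_smarterstart c \<Theta> (Alg \<Theta>)"
  shows "(\<exists>\<Theta>>1. competitive_ratio c (Alg \<Theta>) = ereal rho_star) \<and>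
         (\<forall>\<Theta>>1. ereal rho_star \<le> competitive_ratio c (Alg \<Theta>)) \<and>
         \<bar>Theta_star - 1.7125\<bar> < 0.00005 \<and> \<bar>rho_star - 2.6662\<bar> < 0.00005"
proof -
  have lower: "ereal rho_star \<le> competitive_ratio c (Alg \<Theta>)" if \<Theta>: "1 < \<Theta>" for \<Theta>
    unfolding competitive_ratio_def
  proof (rule Inf_greatest, clarify)
    fix \<alpha> assume ratio: "\<forall>\<sigma>. dar_instance \<sigma> \<longrightarrow> Alg \<Theta> \<sigma> \<le> \<alpha> * Opt c \<sigma>"
    note impl = assms(2)[OF \<Theta>]
    \<comment> \<open>Left of \<open>Theta_star\<close> the decreasing ratio is at least
      \<open>rho_star\<close>, from there to 2 the increasing one is, and beyond 2 the bound
      \<open>27 / 10\<close> applies.\<close>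
    consider "\<Theta> \<le> Theta_star" | "Theta_star \<le> \<Theta>" "\<Theta> \<le> 2" | "2 < \<Theta>" by linarith
    then have "rho_star \<le> \<alpha>"
    proof cases
      case 1
      then show ?thesis
        using waiting_lower_bound[OF assms(1) \<Theta> impl, of \<alpha>] ratio Theta_star_eq Theta_star_bounds
          waiting_ratio_antimono[OF \<Theta> 1] by fastforce
    next
      case 2
      then show ?thesis
        using not_waiting_lower_bound[OF assms(1) \<Theta> 2(2) impl, of \<alpha>] ratio Theta_star_bounds
          not_waiting_ratio_mono[of Theta_star \<Theta>] by (fastforce simp: rho_star_def)
    next
      case 3
      then show ?thesis
        using large_parameter_lower_bound[OF assms(1) 3 impl, of \<alpha>] ratio rho_star_bounds
        unfolding abs_less_iff by fastforce
    qed
    then show "ereal rho_star \<le> ereal \<alpha>" by simp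
  qed
  have \<Theta>: "1 < Theta_star" "Theta_star \<le> 2" using Theta_star_bounds by auto
  \<comment> \<open>At \<open>Theta_star\<close> both ratios equal \<open>rho_star\<close>.\<close>
  have "Alg Theta_star \<sigma> \<le> rho_star * Opt c \<sigma>" if "dar_instance \<sigma>" for \<sigma>
  proof (rule smarterstart_le_Opt[OF assms(1) \<Theta> that])
    show "smarterstart_completion c Theta_star \<sigma> (Alg Theta_star \<sigma>)"
      using assms(2)[OF \<Theta>(1)] that by (simp add: implements_smarterstart_def)
  qed (simp_all add: Theta_star_eq flip: rho_star_def)
  then have "competitive_ratio c (Alg Theta_star) \<le> ereal rho_star"
    unfolding competitive_ratio_def by (intro Inf_lower) auto
  then have "competitive_ratio c (Alg Theta_star) = ereal rho_star"
    using lower[OF \<Theta>(1)] by (rule antisym)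
  moreover have "\<bar>Theta_star - 1.7125\<bar> < 0.00005"
    using Theta_star_bounds unfolding abs_less_iff by simp
  ultimately show ?thesis using lower \<Theta>(1) rho_star_bounds by blast
qed

end
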